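(* Let $\mathbb{K}$ be a field of characteristic zero and let $3\le n\le 5$. Put $X_i:=\sum_{j\neq i}x_{\{i,j\}}$ for $1\le i\le n$. Then the following $\binom n2$ homogeneous invariants form a system of parameters for $\mathcal{I}_n$: $$\sum_{1\le i<j\le n}x_{\{i,j\}}^{k}\quad\Bigl(2\le k\le\tbinom{n-1}{2}\Bigr),\qquad \sum_{i=1}^n X_i^{k}\quad(1\le k\le n).$$
   Context: Let $\mathbb{K}[x_{\{i,j\}}]$ be the polynomial ring in the $m=\binom n2$ variables indexed by the pairs $\{i,j\}$, $1\le i<j\le n$. The symmetric group $\mathfrak{S}_n$ acts on it by $\sigma\cdot x_{\{i,j\}}=x_{\{\sigma(i),\sigma(j)\}}$, and $\mathcal{I}_n:=\mathbb{K}[x_{\{i,j\}}]^{\mathfrak{S}_n}$. A system of parameters of $\mathcal{I}_n$ is a set of $m$ homogeneous invariants $\theta_1,\dots,\theta_m$ such that $\mathcal{I}_n$ is a finitely generated module over its subring $\mathbb{K}[\theta_1,\dots,\theta_m]$. *)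

theory Defs
  imports Complex_Main "HOL-Library.Poly_Mapping" "HOL-Combinatorics.Permutations"
begin

text \<open>
  Multivariate polynomials are finitely supported functions from monomials to coefficients, and
  monomials are finitely supported functions from variables to exponents.  The multiplication of
  \<^theory>\<open>HOL-Library.Poly_Mapping\<close> is convolution, i.e. the product of polynomials.  The variable
  \<open>x\<^bsub>{i,j}\<^esub>\<close> is indexed by the two-element set \<open>{i, j}\<close>.
\<close>

type_synonym 'k graph_poly = "(nat set \<Rightarrow>\<^sub>0 nat) \<Rightarrow>\<^sub>0 'k"

definition Const :: "'k::zero \<Rightarrow> 'k graph_poly" where
  "Const c = Poly_Mapping.single 0 c"

definition Var :: "nat set \<Rightarrow> 'k::zero_neq_one graph_poly" where
  "Var e = Poly_Mapping.single (Poly_Mapping.single e 1) 1"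

definition edges :: "nat \<Rightarrow> nat set set" where
  "edges n = {{i, j} | i j. 1 \<le> i \<and> i < j \<and> j \<le> n}"

text \<open>The type has a variable for every set of naturals; this carves out \<open>K[x\<^bsub>{i,j}\<^esub>]\<close>.\<close>

definition poly_ring :: "nat \<Rightarrow> 'k::zero graph_poly set" where
  "poly_ring n = {p. \<forall>m \<in> Poly_Mapping.keys p. Poly_Mapping.keys m \<subseteq> edges n}"

definition homogeneous :: "'k::zero graph_poly \<Rightarrow> bool" where
  "homogeneous p \<longleftrightarrow> (\<exists>d. \<forall>m \<in> Poly_Mapping.keys p.
     (\<Sum>e \<in> Poly_Mapping.keys m. Poly_Mapping.lookup m e) = d)"

text \<open>The \<open>K\<close>-algebra homomorphism that sends each variable \<open>x\<^sub>e\<close> to \<open>f e\<close>.\<close>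

definition subst :: "(nat set \<Rightarrow> 'k graph_poly) \<Rightarrow> 'k::comm_ring_1 graph_poly \<Rightarrow> 'k graph_poly" where
  "subst f p = (\<Sum>m \<in> Poly_Mapping.keys p. Const (Poly_Mapping.lookup p m) *
     (\<Prod>e \<in> Poly_Mapping.keys m. f e ^ Poly_Mapping.lookup m e))"

definition act :: "(nat \<Rightarrow> nat) \<Rightarrow> 'k::comm_ring_1 graph_poly \<Rightarrow> 'k graph_poly" where
  "act \<sigma> = subst (\<lambda>e. Var (\<sigma> ` e))"

lemma act_Var: "act \<sigma> (Var {i, j}) = Var {\<sigma> i, \<sigma> j}"
  by (simp add: act_def subst_def Var_def Const_def mult_single flip: single_one)

definition invariants :: "nat \<Rightarrow> 'k::comm_ring_1 graph_poly set" where
  "invariants n = {p \<in> poly_ring n. \<forall>\<sigma>. \<sigma> permutes {1..n} \<longrightarrow> act \<sigma> p = p}"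

text \<open>The subring \<open>K[S]\<close>; additive inverses are obtained by multiplying with \<open>Const (- 1)\<close>.\<close>

inductive_set adjoin :: "'k::comm_ring_1 graph_poly set \<Rightarrow> 'k graph_poly set"
  for S :: "'k graph_poly set" where
  const: "Const c \<in> adjoin S"
| gen: "p \<in> S \<Longrightarrow> p \<in> adjoin S"
| add: "p \<in> adjoin S \<Longrightarrow> q \<in> adjoin S \<Longrightarrow> p + q \<in> adjoin S"
| mult: "p \<in> adjoin S \<Longrightarrow> q \<in> adjoin S \<Longrightarrow> p * q \<in> adjoin S"

definition finitely_generated_over ::
    "'k::comm_ring_1 graph_poly set \<Rightarrow> 'k graph_poly set \<Rightarrow> bool" where
  "finitely_generated_over A M \<longleftrightarrow>
     (\<exists>B. finite B \<and> B \<subseteq> M \<and> M = {\<Sum>b\<in>B. c b * b | c. \<forall>b\<in>B. c b \<in> A})"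

definition system_of_parameters :: "nat \<Rightarrow> 'k::comm_ring_1 graph_poly set \<Rightarrow> bool" where
  "system_of_parameters n S \<longleftrightarrow>
     finite S \<and> card S = n choose 2 \<and> S \<subseteq> invariants n \<and> (\<forall>p\<in>S. homogeneous p) \<and>
     finitely_generated_over (adjoin S) (invariants n)"

definition edge_power_sum :: "nat \<Rightarrow> nat \<Rightarrow> 'k::comm_ring_1 graph_poly" where
  "edge_power_sum n k = (\<Sum>i=1..n. \<Sum>j\<in>{i<..n}. Var {i, j} ^ k)"

definition X :: "nat \<Rightarrow> nat \<Rightarrow> 'k::comm_ring_1 graph_poly" where
  "X n i = (\<Sum>j\<in>{1..n} - {i}. Var {i, j})"

definition vertex_power_sum :: "nat \<Rightarrow> nat \<Rightarrow> 'k::comm_ring_1 graph_poly" where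
  "vertex_power_sum n k = (\<Sum>i=1..n. X n i ^ k)"

end

(*  The generators are homogeneous of positive degree, so by a graded Nakayama argument and the
    Reynolds operator it suffices that every variable is nilpotent modulo the ideal that they
    generate.  Let R be the radical of this ideal.  Newton's identities put every X_i into R.

    For n = 3 the X_i span the linear forms.  For n = 4 opposite edges agree modulo R, and the power
    sums of the three remaining classes vanish.

    For n = 5 the six pairs {pentagon, complementary pentagon} of K_5 give linear forms z_0, ..., z_5
    (pentagon sums, one A_5-orbit of pentagons) with sum 0, and modulo R three times an edge variable
    is z_a + z_b + z_c for a block abc of a 2-(6,3,2) design, while the complementary triples give the
    negatives.  So an even power sum of the ten edges is a multiple of the sum of
    (z_a + z_b + z_c)^k over all 3-subsets, a symmetric function of the z_a.  Degrees 2, 4, 6 leave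
    only two free elementary symmetric functions, of degrees 3 and 5.  Since the first six power sums
    of ten elements vanish, so does the twelfth, which kills the former, and ten times the twentieth
    is the square of the tenth, which kills the latter. *)

theory Submission
  imports Defs "HOL-Computational_Algebra.Formal_Power_Series"
begin

section \<open>Newton's identities\<close>

text \<open>The elementary symmetric functions with the signs that they have as coefficients of
  \<open>\<Prod>(T - x\<^sub>i)\<close>.\<close>

definition esym :: "('i \<Rightarrow> 'a::comm_ring_1) \<Rightarrow> 'i set \<Rightarrow> nat \<Rightarrow> 'a" where
  "esym x I = fps_nth (\<Prod>i\<in>I. 1 - fps_const (x i) * fps_X)"

lemma linear_factor_mult_geometric:
  "(1 - fps_const c * fps_X) * Abs_fps (\<lambda>k. c ^ Suc k) = fps_const (c::'a::comm_ring_1)"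
proof (rule fps_ext)
  fix n
  show "fps_nth ((1 - fps_const c * fps_X) * Abs_fps (\<lambda>k. c ^ Suc k)) n = fps_nth (fps_const c) n"
    by (cases n) (simp_all add: left_diff_distrib mult.assoc)
qed

text \<open>The logarithmic derivative of the product, cleared of denominators: each factor
  \<open>1 - x i T\<close> contributes \<open>- x i / (1 - x i T)\<close>, a geometric series, and
  together these generate the power sums.\<close>

lemma newton_fps:
  fixes x :: "'i \<Rightarrow> 'a::comm_ring_1"
  assumes "finite I"
  defines "F \<equiv> \<lambda>I. \<Prod>i\<in>I. 1 - fps_const (x i) * fps_X"
  shows "fps_deriv (F I) = - F I * Abs_fps (\<lambda>k. \<Sum>i\<in>I. x i ^ Suc k)"
  using assms(1)
proof (induction I)
  case empty
  show ?case by (simp add: F_def fps_eq_iff)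
next
  case (insert i I)
  define u where "u = 1 - fps_const (x i) * fps_X"
  define G where "G = Abs_fps (\<lambda>k. \<Sum>i\<in>I. x i ^ Suc k)"
  define g where "g = Abs_fps (\<lambda>k. x i ^ Suc k)"
  have F: "F (insert i I) = u * F I"
    using insert.hyps by (simp add: F_def u_def)
  have G: "Abs_fps (\<lambda>k. \<Sum>i\<in>insert i I. x i ^ Suc k) = g + G"
    using insert.hyps by (simp add: g_def G_def fps_eq_iff)
  have ug: "u * g = fps_const (x i)"
    unfolding u_def g_def by (rule linear_factor_mult_geometric)
  have "fps_deriv u = - fps_const (x i)"
    by (simp add: u_def)
  then have "fps_deriv (u * F I) = - (u * g) * F I - u * F I * G"
    using insert.IH ug by (simp add: G_def algebra_simps)
  then show ?case
    unfolding F G by (simp add: algebra_simps eq_neg_iff_add_eq_0)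
qed

text \<open>Coefficient \<open>k\<close> of the identity in \<open>newton_fps\<close>. The factor
  \<open>of_nat (Suc k)\<close> comes from the derivative and stays on the left because the ring may
  not allow division by integers.\<close>

lemma newton:
  fixes x :: "'i \<Rightarrow> 'a::comm_ring_1"
  assumes "finite I"
  shows "of_nat (Suc k) * esym x I (Suc k) = - (\<Sum>j\<le>k. esym x I j * (\<Sum>i\<in>I. x i ^ (Suc k - j)))"
proof -
  have "of_nat (Suc k) * esym x I (Suc k)
      = fps_nth (- (\<Prod>i\<in>I. 1 - fps_const (x i) * fps_X) * Abs_fps (\<lambda>k. \<Sum>i\<in>I. x i ^ Suc k)) k"
    using arg_cong[OF newton_fps[OF assms], of "\<lambda>f. fps_nth f k" x] by (simp add: esym_def)
  also have "\<dots> = - (\<Sum>j\<le>k. esym x I j * (\<Sum>i\<in>I. x i ^ Suc (k - j)))"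
    by (simp only: fps_mult_nth mult_minus_left fps_neg_nth fps_nth_Abs_fps esym_def sum_negf atLeast0AtMost)
  also have "(\<Sum>j\<le>k. esym x I j * (\<Sum>i\<in>I. x i ^ Suc (k - j)))
      = (\<Sum>j\<le>k. esym x I j * (\<Sum>i\<in>I. x i ^ (Suc k - j)))"
    by (rule sum.cong) (simp_all add: Suc_diff_le)
  finally show ?thesis .
qed

lemma esym_0 [simp]: "esym x I 0 = 1"
  by (induction I rule: infinite_finite_induct) (simp_all add: esym_def)

lemma esym_insert_Suc:
  "finite I \<Longrightarrow> i \<notin> I \<Longrightarrow> esym x (insert i I) (Suc k) = esym x I (Suc k) - x i * esym x I k"
  by (simp add: esym_def left_diff_distrib mult.assoc)

lemma esym_eq_0: "finite I \<Longrightarrow> card I < k \<Longrightarrow> esym x I k = 0"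
proof (induction I arbitrary: k rule: finite_induct)
  case empty
  then show ?case by (simp add: esym_def)
next
  case (insert i I)
  then show ?case by (cases k) (simp_all add: esym_insert_Suc)
qed

text \<open>Beyond the number of elements \<open>esym\<close> vanishes, so \<open>newton\<close>
  loses its left side and its high terms. At \<open>k = card I\<close> the left side survives and is
  exactly the term \<open>j = card I\<close>, whose power sum of exponent 0 equals
  \<open>card I\<close>.\<close>

lemma newton_recurrence:
  fixes x :: "'i \<Rightarrow> 'a::comm_ring_1"
  assumes "finite I" "card I \<le> k"
  shows "(\<Sum>j\<le>card I. esym x I j * (\<Sum>i\<in>I. x i ^ (k - j))) = 0"
proof (cases "k = card I")
  case True
  show ?thesis
  proof (cases k)
    case 0
    with True assms show ?thesis by simp
  next
    case (Suc m)
    then show ?thesis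
      using newton[OF assms(1), of m x] True by (simp add: mult.commute)
  qed
next
  case False
  with assms obtain m where k: "k = Suc m" "card I \<le> m"
    by (cases k) auto
  have "(\<Sum>j\<le>card I. esym x I j * (\<Sum>i\<in>I. x i ^ (k - j)))
      = (\<Sum>j\<le>m. esym x I j * (\<Sum>i\<in>I. x i ^ (k - j)))"
    using k by (intro sum.mono_neutral_left) (auto simp: esym_eq_0 assms)
  also have "\<dots> = 0"
    using newton[OF assms(1), of m x] k by (simp add: esym_eq_0 assms)
  finally show ?thesis .
qed

text \<open>The sum is the monic polynomial whose zeros are the elements of the family, evaluated at
  its zero \<open>x i\<close>.\<close>

lemma esym_root:
  fixes x :: "'i \<Rightarrow> 'a::comm_ring_1"
  assumes "finite I" "i \<in> I"
  shows "(\<Sum>j\<le>card I. esym x I j * x i ^ (card I - j)) = 0"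
proof -
  define J where "J = I - {i}"
  have J: "finite J" "i \<notin> J" "I = insert i J" "card I = Suc (card J)"
    using assms card_Suc_Diff1[OF assms] by (auto simp: J_def)
  \<comment> \<open>Horner's scheme: the partial sums are the coefficients of the quotient by
    \<open>T - x i\<close>, that is, of the polynomial of the remaining elements.\<close>
  have "(\<Sum>j\<le>m. esym x I j * x i ^ (m - j)) = esym x J m" for m
  proof (induction m)
    case (Suc m)
    have "(\<Sum>j\<le>Suc m. esym x I j * x i ^ (Suc m - j))
        = esym x I (Suc m) + x i * (\<Sum>j\<le>m. esym x I j * x i ^ (m - j))"
      by (simp add: Suc_diff_le sum_distrib_left mult_ac)
    also have "\<dots> = esym x J (Suc m)"
      unfolding Suc.IH by (simp add: J(3) esym_insert_Suc J(1,2))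
    finally show ?case .
  qed simp
  then show ?thesis
    using esym_eq_0[OF J(1), of "card I" x] J(4) by simp
qed

section \<open>Power sums of the sums of three out of six elements\<close>

text \<open>Multiplication of exponential generating functions. For power sums it multiplies sums of
  exponentials, which is why \<open>binconv_power_sums\<close> yields the power sums of all
  \<open>u a + v b\<close>.\<close>

definition binconv :: "(nat \<Rightarrow> 'a::comm_ring_1) \<Rightarrow> (nat \<Rightarrow> 'a) \<Rightarrow> nat \<Rightarrow> 'a" where
  "binconv f g k = (\<Sum>i\<le>k. of_nat (k choose i) * (f i * g (k - i)))"

lemma binconv_power_sums:
  "binconv (\<lambda>k. \<Sum>a\<in>A. u a ^ k) (\<lambda>k. \<Sum>b\<in>B. v b ^ k) k = (\<Sum>a\<in>A. \<Sum>b\<in>B. (u a + v b) ^ k)"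
proof -
  have "(\<Sum>a\<in>A. \<Sum>b\<in>B. (u a + v b) ^ k)
      = (\<Sum>a\<in>A. \<Sum>i\<le>k. \<Sum>b\<in>B. of_nat (k choose i) * (u a ^ i * v b ^ (k - i)))"
    by (subst sum.swap) (simp add: binomial_ring mult.assoc)
  also have "\<dots> = (\<Sum>i\<le>k. \<Sum>a\<in>A. \<Sum>b\<in>B. of_nat (k choose i) * (u a ^ i * v b ^ (k - i)))"
    by (rule sum.swap)
  finally show ?thesis
    unfolding binconv_def sum_product by (simp only: sum_distrib_left)
qed

text \<open>Inclusion-exclusion for the sum of \<open>(z\<^sub>a + z\<^sub>b + z\<^sub>c)\<^sup>k\<close> over ordered triples of
  distinct indices, expressed through the power sums \<open>q\<close> of \<open>z\<close>.\<close>

definition triple_poly :: "(nat \<Rightarrow> 'a::comm_ring_1) \<Rightarrow> nat \<Rightarrow> 'a" where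
  "triple_poly q k = binconv q (binconv q q) k - 3 * binconv (\<lambda>i. 2 ^ i * q i) q k + 2 * (3 ^ k * q k)"

definition pair_sum :: "('i \<Rightarrow> 'i \<Rightarrow> 'a::comm_ring_1) \<Rightarrow> 'i set \<Rightarrow> 'a" where
  "pair_sum h I = (\<Sum>b\<in>I. \<Sum>c\<in>I. h b c) - (\<Sum>b\<in>I. h b b)"

text \<open>Meant for symmetric \<open>g\<close>: the factor 3 merges the three ways in which two
  positions of a triple can coincide.\<close>

definition triple_sum :: "('i \<Rightarrow> 'i \<Rightarrow> 'i \<Rightarrow> 'a::comm_ring_1) \<Rightarrow> 'i set \<Rightarrow> 'a" where
  "triple_sum g I = (\<Sum>a\<in>I. \<Sum>b\<in>I. \<Sum>c\<in>I. g a b c)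
     - 3 * (\<Sum>a\<in>I. \<Sum>b\<in>I. g a a b) + 2 * (\<Sum>a\<in>I. g a a a)"

lemma pair_sum_empty: "pair_sum h {} = 0"
  by (simp add: pair_sum_def)

lemma triple_sum_empty: "triple_sum g {} = 0"
  by (simp add: triple_sum_def)

lemma pair_sum_insert:
  assumes "finite I" "i \<notin> I" "\<And>b c. h b c = h c b"
  shows "pair_sum h (insert i I) = pair_sum h I + 2 * (\<Sum>b\<in>I. h i b)"
proof -
  have "(\<Sum>b\<in>I. h b i) = (\<Sum>b\<in>I. h i b)"
    by (rule sum.cong) (simp_all add: assms(3)[of i])
  with assms(1,2) show ?thesis
    by (simp add: pair_sum_def sum.distrib)
qed

text \<open>The new index can occupy three positions of a triple of distinct indices; the other two
  positions form an ordered pair from \<open>I\<close>. Iteration enumerates the triples of a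
  concrete set.\<close>

lemma triple_sum_insert:
  assumes "finite I" "i \<notin> I" "\<And>a b c. g a b c = g b a c" "\<And>a b c. g a b c = g a c b"
  shows "triple_sum g (insert i I) = triple_sum g I + 3 * pair_sum (g i) I"
proof -
  have sym: "(\<Sum>a\<in>I. \<Sum>b\<in>I. g a b i) = (\<Sum>a\<in>I. \<Sum>b\<in>I. g i a b)"
    "(\<Sum>a\<in>I. \<Sum>b\<in>I. g a i b) = (\<Sum>a\<in>I. \<Sum>b\<in>I. g i a b)"
    "(\<Sum>a\<in>I. g a i i) = (\<Sum>a\<in>I. g i i a)" "(\<Sum>a\<in>I. g i a i) = (\<Sum>a\<in>I. g i i a)"
    "(\<Sum>a\<in>I. g a a i) = (\<Sum>a\<in>I. g i a a)"
    by (intro sum.cong refl; metis assms(3,4))+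
  show ?thesis
    using assms(1,2) by (simp add: triple_sum_def pair_sum_def sum.distrib sym algebra_simps)
qed

lemma triple_poly_power_sums:
  fixes z :: "'i \<Rightarrow> 'a::comm_ring_1"
  shows "triple_poly (\<lambda>k. \<Sum>a\<in>I. z a ^ k) k =
triple_sum (\<lambda>a b c. (z a + (z b + z c)) ^ k) I"
proof -
  have pairs: "binconv (\<lambda>k. \<Sum>a\<in>I. z a ^ k) (\<lambda>k. \<Sum>a\<in>I. z a ^ k)
      = (\<lambda>k. \<Sum>p\<in>I \<times> I. (case p of (a, b) \<Rightarrow> z a + z b) ^ k)"
    by (rule ext) (simp add: binconv_power_sums sum.cartesian_product case_prod_unfold)
  have triples: "binconv (\<lambda>k. \<Sum>a\<in>I. z a ^ k) (binconv (\<lambda>k. \<Sum>a\<in>I. z a ^ k) (\<lambda>k. \<Sum>a\<in>I. z a ^ k)) k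
      = (\<Sum>a\<in>I. \<Sum>b\<in>I. \<Sum>c\<in>I. (z a + (z b + z c)) ^ k)"
    unfolding pairs by (simp add: binconv_power_sums sum.cartesian_product case_prod_unfold)
  have doubled: "binconv (\<lambda>k. 2 ^ k * (\<Sum>a\<in>I. z a ^ k)) (\<lambda>k. \<Sum>a\<in>I. z a ^ k) k
      = (\<Sum>a\<in>I. \<Sum>b\<in>I. (2 * z a + z b) ^ k)"
    using binconv_power_sums[of "\<lambda>a. 2 * z a" I z I k] by (simp add: power_mult_distrib sum_distrib_left)
  have tripled: "3 ^ k * (\<Sum>a\<in>I. z a ^ k) = (\<Sum>a\<in>I. (3 * z a) ^ k)"
    by (simp add: sum_distrib_left power_mult_distrib)
  have multiples: "2 * z a + z b = z a + (z a + z b)" "3 * z a = z a + (z a + z a)" for a b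
    by simp_all
  show ?thesis
    unfolding triple_poly_def triples doubled triple_sum_def tripled by (simp only: multiples)
qed

text \<open>Six is the number of orderings of a 3-subset. The twenty subsets are listed in
  complementary pairs, in the order in which \<open>edges_mem_5\<close> matches them with
  \<open>3\<close> and \<open>-3\<close> times the ten edges.\<close>

lemma triple_poly_blocks:
  fixes z :: "nat \<Rightarrow> 'a::comm_ring_1"
  shows "triple_poly (\<lambda>k. \<Sum>a<6. z a ^ k) k = 6 *
    ((z 0 + z 1 + z 2) ^ k + (z 3 + z 4 + z 5) ^ k + (z 1 + z 3 + z 4) ^ k + (z 0 + z 2 + z 5) ^ k
   + (z 2 + z 3 + z 5) ^ k + (z 0 + z 1 + z 4) ^ k + (z 0 + z 4 + z 5) ^ k + (z 1 + z 2 + z 3) ^ k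
   + (z 0 + z 3 + z 5) ^ k + (z 1 + z 2 + z 4) ^ k + (z 1 + z 4 + z 5) ^ k + (z 0 + z 2 + z 3) ^ k
   + (z 2 + z 3 + z 4) ^ k + (z 0 + z 1 + z 5) ^ k + (z 0 + z 2 + z 4) ^ k + (z 1 + z 3 + z 5) ^ k
   + (z 1 + z 2 + z 5) ^ k + (z 0 + z 3 + z 4) ^ k + (z 0 + z 1 + z 3) ^ k + (z 2 + z 4 + z 5) ^ k)"
proof -
  have 6: "{..<6} = {0, 1, 2, 3, 4, 5 :: nat}"
    by auto
  define g where "g = (\<lambda>a b c. (z a + (z b + z c)) ^ k)"
  have g: "g a b c = g b a c" "g a b c = g a c b" for a b c
    by (simp_all add: g_def ac_simps)
  have "triple_sum g {..<6} = 6 * (g 0 1 2 + g 3 4 5 + g 1 3 4 + g 0 2 5 + g 2 3 5 + g 0 1 4 + g 0 4 5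
    + g 1 2 3 + g 0 3 5 + g 1 2 4 + g 1 4 5 + g 0 2 3 + g 2 3 4 + g 0 1 5 + g 0 2 4 + g 1 3 5 + g 1 2 5
    + g 0 3 4 + g 0 1 3 + g 2 4 5)"
  proof -
    note ins = triple_sum_insert[where g = g, OF _ _ g] pair_sum_insert[where h = "g a" for a, OF _ _ g(2)]
    have e: "triple_sum g {0, 1, 2, 3, 4, 5} = 
      3 * pair_sum (g 4) {5} + 3 * pair_sum (g 3) {4, 5} + 3 * pair_sum (g 2) {3, 4, 5}
      + 3 * pair_sum (g 1) {2, 3, 4, 5} + 3 * pair_sum (g 0) {1, 2, 3, 4, 5}"
      by (simp add: ins(1) triple_sum_empty pair_sum_empty)
    have p: "pair_sum (g a) {5} = 0"
       "pair_sum (g a) {4,5} = 2 * g a 4 5"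
       "pair_sum (g a) {3,4,5} = 2 * g a 4 5 + 2 * (g a 3 4 + g a 3 5)"
       "pair_sum (g a) {2,3,4,5} = 2 * g a 4 5 + 2 * (g a 3 4 + g a 3 5) + 2 * (g a 2 3 + (g a 2 4 + g a 2 5))"
       "pair_sum (g a) {1,2,3,4,5} = 2 * g a 4 5 + 2 * (g a 3 4 + g a 3 5) + 2 * (g a 2 3 + (g a 2 4
           + g a 2 5)) + 2 * (g a 1 2 + (g a 1 3 + (g a 1 4 + g a 1 5)))" for a
      by (simp_all add: ins pair_sum_empty)
    show ?thesis
      unfolding 6 e p
      by (simp only: distrib_left mult.assoc[symmetric] numeral_times_numeral mult_num_simps add_num_simps
          mult_zero_right add_0 add_ac)
  qed
  moreover have "triple_poly (\<lambda>k. \<Sum>a<6. z a ^ k) k = triple_sum g {..<6}"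
    unfolding g_def by (rule triple_poly_power_sums)
  moreover have "g a b c = (z a + z b + z c) ^ k" for a b c
    by (simp only: g_def add.assoc)
  ultimately show ?thesis
    by (simp only:)
qed

section \<open>Values of \<open>triple_poly\<close> in degrees 10, 12 and 20\<close>

lemma sum_atMost_numeral:
  "(\<Sum>i\<le>numeral k. f i) = (\<Sum>i\<le>pred_numeral k. f i) + (f (numeral k) :: 'a::comm_monoid_add)"
  by (simp add: numeral_eq_Suc)

lemmas binconv_eval = binconv_def sum_atMost_numeral binomial_fact' fact_numeral

text \<open>Only multiples of \<open>d\<close> contribute; with \<open>d = 5\<close> a convolution
  of degree 20 shrinks to five terms.\<close>

lemma binconv_multiples:
  assumes "\<And>i. \<not> d dvd i \<Longrightarrow> f i = 0" "d > 0"
  shows "binconv f g (d * m) = (\<Sum>j\<le>m. of_nat (d * m choose (d * j)) * (f (d * j) * g (d * (m - j))))"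
proof -
  have "bij_betw (\<lambda>j. d * j) {..m} {i \<in> {..d * m}. d dvd i}"
    using assms(2) by (auto simp: bij_betw_def inj_on_def elim!: dvdE)
  from sum.reindex_bij_betw[OF this, of "\<lambda>i. of_nat (d * m choose i) * (f i * g (d * m - i))"]
  show ?thesis
    unfolding binconv_def
    by (subst sum.mono_neutral_right[of _ "{i \<in> {..d * m}. d dvd i}"]) (auto simp: assms(1) diff_mult_distrib2)
qed

text \<open>Here \<open>q\<close> behaves like the power sums of 0 and the five zeros of
  \<open>T^5 + s\<close>.\<close>

lemma triple_poly_10_20:
  fixes s :: "'a::comm_ring_1"
  assumes supp: "\<And>i. \<not> 5 dvd i \<Longrightarrow> q i = 0"
    and q: "q 0 = 6" "q 5 = - (5 * s)" "q 10 = 5 * s ^ 2" "q 15 = - (5 * s ^ 3)" "q 20 = 5 * s ^ 4"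
  shows "triple_poly q 10 = 7380 * s ^ 2" "triple_poly q 20 = 907620 * s ^ 4"
proof -
  note conv = binconv_multiples[where d = 5, of q, OF supp]
    binconv_multiples[where d = 5, of "\<lambda>i. 2 ^ i * q i"]
  note eval = sum_atMost_numeral binomial_fact' fact_numeral q
  note pows = power2_eq_square power3_eq_cube power4_eq_xxxx algebra_simps
  have pairs: "binconv q q 0 = 36" "binconv q q 5 = - (60 * s)" "binconv q q 10 = 6360 * s ^ 2"
    "binconv q q 15 = - (150210 * s ^ 3)" "binconv q q 20 = 5394160 * s ^ 4"
    using conv(1)[of q 0] conv(1)[of q 1] conv(1)[of q 2] conv(1)[of q 3] conv(1)[of q 4]
    by (simp_all add: eval) (simp_all add: pows)
  have "binconv q (binconv q q) 10 = 113940 * s ^ 2" "binconv q (binconv q q) 20 = 17556536340 * s ^ 4"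
    using conv(1)[of "binconv q q" 2] conv(1)[of "binconv q q" 4]
    by (simp_all add: eval pairs) (simp_all add: pows)
  moreover have "binconv (\<lambda>i. 2 ^ i * q i) q 10 = 232350 * s ^ 2"
    "binconv (\<lambda>i. 2 ^ i * q i) q 20 = 17474490910 * s ^ 4"
    using conv(2)[of q 2] conv(2)[of q 4]
    by (simp_all add: eval supp) (simp_all add: pows)
  ultimately show "triple_poly q 10 = 7380 * s ^ 2" "triple_poly q 20 = 907620 * s ^ 4"
    by (simp_all add: triple_poly_def q algebra_simps)
qed

text \<open>The values of \<open>q\<close> here and in \<open>triple_poly_10_20\<close> are what Newton's recurrence yields in the proof
  of \<open>six_power_sums\<close>, where \<open>a\<close>, \<open>b\<close>, \<open>c\<close> are the signed elementary symmetric functions of degrees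
  3, 5, 6, subject to \<open>a\<^sup>2 = 22 c\<close>; there, \<open>s = b\<close> once \<open>a = c = 0\<close>.\<close>

lemma triple_poly_12:
  fixes a b c :: "'a::comm_ring_1"
  defines "q \<equiv> nth [6, 0, 0, - (3 * a), 0, - (5 * b), 60 * c, 0, 8 * (a * b), - (57 * (a * c)),
    5 * b ^ 2, - (231 * (b * c)), 1194 * c ^ 2]"
  shows "triple_poly q 12 = 602363736 * c ^ 2 - 27395280 * c * a ^ 2"
proof -
  have q: "q 0 = 6" "q 1 = 0" "q 2 = 0" "q 3 = - (3 * a)" "q 4 = 0" "q 5 = - (5 * b)" "q 6 = 60 * c"
    "q 7 = 0" "q 8 = 8 * (a * b)" "q 9 = - (57 * (a * c))" "q 10 = 5 * b ^ 2" "q 11 = - (231 * (b * c))"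
    "q 12 = 1194 * c ^ 2" "q (Suc 0) = 0"
    by (simp_all add: q_def)
  have pairs:
    "binconv q q 0 = 36"
    "binconv q q 1 = 0"
    "binconv q q 2 = 0"
    "binconv q q 3 = - (36 * a)"
    "binconv q q 4 = 0"
    "binconv q q 5 = - (60 * b)"
    "binconv q q 6 = 720 * c + 180 * a ^ 2"
    "binconv q q 7 = 0"
    "binconv q q 8 = 1776 * (a * b)"
    "binconv q q 9 = - (30924 * (a * c))"
    "binconv q q 10 = 6360 * b ^ 2"
    "binconv q q 11 = - (279972 * (b * c)) - 7920 * (a ^ 2 * b)"
    "binconv q q 12 = 3340728 * c ^ 2 + 75240 * (a ^ 2 * c)"
    by (simp_all add: binconv_def sum_atMost_numeral q)
       (simp_all add: binomial_fact' fact_numeral power2_eq_square algebra_simps)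
  have "binconv q (binconv q q) 12 = 60004152 * c ^ 2 + 31291920 * (a ^ 2 * c)"
    unfolding binconv_def[of q "binconv q q"]
    apply (simp add: sum_atMost_numeral)
    apply (simp add: q pairs pairs(2)[unfolded One_nat_def])
    apply (simp add: binomial_fact' fact_numeral power2_eq_square algebra_simps)
    done
  moreover have "binconv (\<lambda>i. 2 ^ i * q i) q 12 = 242240508 * c ^ 2 + 19562400 * (a ^ 2 * c)"
    by (simp add: binconv_def sum_atMost_numeral q)
       (simp add: binomial_fact' fact_numeral power2_eq_square algebra_simps)
  ultimately show ?thesis
    by (simp add: triple_poly_def q algebra_simps)
qed

section \<open>Computing modulo a radical ideal\<close>

text \<open>Models a radical ideal in an algebra over a field of characteristic zero:
  \<open>of_nat_cancel\<close> makes the integer factors in Newton's identities harmless. The case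
  \<open>k = 0\<close> of \<open>root\<close> says that an ideal containing 1 is the whole
  ring.\<close>

locale radical_ideal =
  fixes R :: "'a::comm_ring_1 set"
  assumes zero: "0 \<in> R"
    and add: "a \<in> R \<Longrightarrow> b \<in> R \<Longrightarrow> a + b \<in> R"
    and mult: "a \<in> R \<Longrightarrow> c * a \<in> R"
    and root: "a ^ k \<in> R \<Longrightarrow> a \<in> R"
    and of_nat_cancel: "of_nat k * a \<in> R \<Longrightarrow> k \<noteq> 0 \<Longrightarrow> a \<in> R"
begin

lemma mult': "a \<in> R \<Longrightarrow> a * c \<in> R"
  using mult[of a c] by (simp add: mult.commute)

lemma minus: "a \<in> R \<Longrightarrow> - a \<in> R"
  using mult[of a "- 1"] by simp

lemma minus_iff: "- a \<in> R \<longleftrightarrow> a \<in> R"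
  using minus[of a] minus[of "- a"] by auto

lemma diff: "a \<in> R \<Longrightarrow> b \<in> R \<Longrightarrow> a - b \<in> R"
  using add[of a "- b"] minus by simp

lemma sum: "(\<And>i. i \<in> I \<Longrightarrow> f i \<in> R) \<Longrightarrow> (\<Sum>i\<in>I. f i) \<in> R"
  by (induction I rule: infinite_finite_induct) (simp_all add: zero add)

lemma numeral_cancel: "numeral w * a \<in> R \<Longrightarrow> a \<in> R"
  using of_nat_cancel[of "numeral w" a] by simp

definition eqv :: "'a \<Rightarrow> 'a \<Rightarrow> bool" (infix \<open>\<approx>\<close> 50) where
  "a \<approx> b \<longleftrightarrow> a - b \<in> R"

lemma eqv_refl [simp]: "a \<approx> a"
  by (simp add: eqv_def zero)

lemma eqv_trans [trans]: "a \<approx> b \<Longrightarrow> b \<approx> c \<Longrightarrow> a \<approx> c"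
  using add[of "a - b" "b - c"] by (simp add: eqv_def)

lemma eqv_add: "a \<approx> a' \<Longrightarrow> b \<approx> b' \<Longrightarrow> a + b \<approx> a' + b'"
  using add[of "a - a'" "b - b'"] by (simp add: eqv_def algebra_simps)

lemma eqv_minus: "a \<approx> a' \<Longrightarrow> - a \<approx> - a'"
  using minus[of "a - a'"] by (simp add: eqv_def)

lemma eqv_diff: "a \<approx> a' \<Longrightarrow> b \<approx> b' \<Longrightarrow> a - b \<approx> a' - b'"
  using eqv_add[of a a' "- b" "- b'"] eqv_minus by simp

lemma eqv_mult: "a \<approx> a' \<Longrightarrow> b \<approx> b' \<Longrightarrow> a * b \<approx> a' * b'"
  using add[OF mult[of "b - b'" a] mult[of "a - a'" b']] by (simp add: eqv_def algebra_simps)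

lemma eqv_power: "a \<approx> a' \<Longrightarrow> a ^ k \<approx> a' ^ k"
  by (induction k) (simp_all add: eqv_mult)

lemma eqv_sum: "(\<And>i. i \<in> I \<Longrightarrow> f i \<approx> g i) \<Longrightarrow> (\<Sum>i\<in>I. f i) \<approx> (\<Sum>i\<in>I. g i)"
  by (induction I rule: infinite_finite_induct) (simp_all add: eqv_add)

lemma eqv_mem: "a \<approx> b \<Longrightarrow> a \<in> R \<longleftrightarrow> b \<in> R"
  using add[of "a - b" b] diff[of a "a - b"] by (auto simp: eqv_def)

lemma eqv_0_iff: "a \<approx> 0 \<longleftrightarrow> a \<in> R"
  by (simp add: eqv_def)

text \<open>Every term on the right of \<open>newton\<close> carries a power sum of index between 1
  and \<open>k\<close>, so the identity itself, without induction, puts \<open>k\<close> times the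
  left-hand function into \<open>R\<close>.\<close>

lemma esym_mem:
  assumes "finite I"
      "\<And>k. 1 \<le> k \<Longrightarrow> k \<le> m \<Longrightarrow> (\<Sum>i\<in>I. x i ^ k) \<in> R"
      "1 \<le> k" "k \<le> m"
  shows "esym x I k \<in> R"
proof -
  obtain l where k: "k = Suc l"
    using assms(3) by (cases k) auto
  have "of_nat k * esym x I k \<in> R"
    unfolding k newton[OF assms(1)] using assms(4) k by (intro minus sum mult assms(2)) auto
  then show ?thesis
    using of_nat_cancel k by blast
qed

text \<open>Modulo \<open>R\<close> the polynomial with zeros \<open>x i\<close> reduces to its
  leading term, so \<open>esym_root\<close> gives \<open>x i ^ card I \<in> R\<close>. This is how
  vanishing power sums become vanishing elements.\<close>

lemma power_sums_imp_mem:
  assumes "finite I" "\<And>k. 1 \<le> k \<Longrightarrow> k \<le> card I \<Longrightarrow> (\<Sum>i\<in>I. x i ^ k) \<in> R" "i \<in> I"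
  shows "x i \<in> R"
proof -
  have "(\<Sum>j\<le>card I. esym x I j * x i ^ (card I - j))
      = x i ^ card I + (\<Sum>j\<in>{..card I} - {0}. esym x I j * x i ^ (card I - j))"
    by (subst sum.remove[of _ 0]) auto
  then have "x i ^ card I + (\<Sum>j\<in>{..card I} - {0}. esym x I j * x i ^ (card I - j)) = 0"
    using esym_root[OF assms(1,3), of x] by argo
  then have "x i ^ card I = - (\<Sum>j\<in>{..card I} - {0}. esym x I j * x i ^ (card I - j))"
    by (simp add: eq_neg_iff_add_eq_0)
  moreover have "(\<Sum>j\<in>{..card I} - {0}. esym x I j * x i ^ (card I - j)) \<in> R"
    by (intro sum mult' esym_mem[OF assms(1,2)]) auto
  ultimately show ?thesis
    using root minus by metis
qed

text \<open>Modulo \<open>R\<close> only \<open>f 7\<close> to \<open>f 10\<close> survive. The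
  recurrence expresses \<open>p 11\<close>, \<open>p 12\<close>, \<open>p 13\<close> through
  \<open>p 1\<close> to \<open>p 6\<close>, gives \<open>p 10\<close> as
  \<open>- (10 * f 10)\<close> because \<open>p 0 = 10\<close>, and leaves \<open>p 20\<close> with
  the single term \<open>- (f 10 * p 10)\<close>, which is \<open>10 * f 10 ^ 2\<close>.\<close>

lemma ten_power_sums:
  assumes "finite I" "card I = 10" "\<And>k. 1 \<le> k \<Longrightarrow> k \<le> 6 \<Longrightarrow> (\<Sum>i\<in>I. x i ^ k) \<in> R"
  shows "(\<Sum>i\<in>I. x i ^ 12) \<in> R" "10 * (\<Sum>i\<in>I. x i ^ 20) - (\<Sum>i\<in>I. x i ^ 10) ^ 2 \<in> R"
proof -
  define p where "p k = (\<Sum>i\<in>I. x i ^ k)" for k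
  define f where "f = esym x I"
  have f: "f k \<in> R" if "k \<in> {1..6}" for k
    using esym_mem[OF assms(1,3), of k] that by (simp add: f_def)
  have small: "p k \<in> R" if "k \<in> {1..6}" for k
    using assms(3)[of k] that by (simp add: p_def)
  have rec: "p k \<approx> - (f 7 * p (k - 7) + f 8 * p (k - 8) + f 9 * p (k - 9) + f 10 * p (k - 10))"
    if "10 \<le> k" for k
  proof -
    have "(\<Sum>j\<le>10. f j * p (k - j)) = 0"
      using newton_recurrence[OF assms(1), of k x] that assms(2) by (simp add: p_def f_def)
    then have "p k - (- (f 7 * p (k - 7) + f 8 * p (k - 8) + f 9 * p (k - 9) + f 10 * p (k - 10)))
        = - (f 1 * p (k - 1) + f 2 * p (k - 2) + f 3 * p (k - 3) + f 4 * p (k - 4)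
           + f 5 * p (k - 5) + f 6 * p (k - 6))"
      by (simp add: eval_nat_numeral f_def algebra_simps eq_neg_iff_add_eq_0)
    also have "\<dots> \<in> R"
      by (intro minus add mult') (auto intro: f)
    finally show ?thesis
      by (simp add: eqv_def)
  qed
  have p10: "p 10 \<approx> - (10 * f 10)"
  proof -
    have "p 10 \<approx> - (f 7 * p 3 + f 8 * p 2 + f 9 * p 1 + f 10 * p 0)"
      using rec[of 10] by simp
    also have "\<dots> \<approx> - (0 + 0 + 0 + f 10 * p 0)"
      by (intro eqv_minus eqv_add eqv_refl) (simp_all only: eqv_0_iff mult small atLeastAtMost_iff, simp_all add: mult small)
    also have "p 0 = 10"
      by (simp add: p_def assms(2))
    finally show ?thesis by (simp add: mult.commute)
  qed
  have mid: "p k \<in> R" if "11 \<le> k" "k \<le> 13" for k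
  proof -
    have "k - 7 \<in> {1..6}" "k - 8 \<in> {1..6}" "k - 9 \<in> {1..6}" "k - 10 \<in> {1..6}"
      using that by auto
    then have "- (f 7 * p (k - 7) + f 8 * p (k - 8) + f 9 * p (k - 9) + f 10 * p (k - 10)) \<in> R"
      by (intro minus add mult small)
    then show ?thesis
      using eqv_mem[OF rec[of k]] that by simp
  qed
  show "(\<Sum>i\<in>I. x i ^ 12) \<in> R"
    using mid[of 12] by (simp add: p_def)
  have "p 20 \<approx> - (f 7 * p 13 + f 8 * p 12 + f 9 * p 11 + f 10 * p 10)"
    using rec[of 20] by simp
  also have "\<dots> \<approx> - (0 + 0 + 0 + f 10 * - (10 * f 10))"
    by (intro eqv_minus eqv_add eqv_mult[OF eqv_refl p10]) (simp_all add: eqv_0_iff mult mid)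
  finally have "10 * p 20 - p 10 ^ 2 \<approx> 10 * (- (0 + 0 + 0 + f 10 * - (10 * f 10))) - (- (10 * f 10)) ^ 2"
    by (intro eqv_diff eqv_mult eqv_refl eqv_power p10)
  then have "10 * p 20 - p 10 ^ 2 \<approx> 0"
    by (simp add: power2_eq_square mult_ac)
  then show "10 * (\<Sum>i\<in>I. x i ^ 20) - (\<Sum>i\<in>I. x i ^ 10) ^ 2 \<in> R"
    by (simp add: p_def eqv_0_iff)
qed

lemma eqv_triple_poly: 
  assumes "\<And>i. i \<le> k \<Longrightarrow> q i \<approx> q' i"
  shows "triple_poly q k \<approx> triple_poly q' k"
proof -
  have conv: "binconv f g l \<approx> binconv f' g' l"
    if "\<And>i. i \<le> l \<Longrightarrow> f i \<approx> f' i" "\<And>i. i \<le> l \<Longrightarrow> g i \<approx> g' i" for f g f' g' l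
    unfolding binconv_def by (intro eqv_sum eqv_mult eqv_refl that) auto
  show ?thesis
    unfolding triple_poly_def by (intro eqv_add eqv_diff eqv_mult eqv_refl conv assms) auto
qed

text \<open>For the ten edge power sums \<open>p\<^sub>k\<close>, \<open>triple_poly q k\<close> is \<open>12 \<cdot> 3\<^sup>k \<cdot> p\<^sub>k\<close> for even \<open>k\<close>, so the last
  hypothesis is \<open>p\<^sub>2\<^sub>0 = p\<^sub>1\<^sub>0\<^sup>2 / 10\<close> in disguise.\<close>

lemma six_power_sums:
  fixes z :: "nat \<Rightarrow> 'a"
  defines "q \<equiv> \<lambda>k. \<Sum>a<6. z a ^ k"
  assumes q1: "q 1 \<in> R"
    and P: "\<And>k. k \<in> {2, 4, 6, 12} \<Longrightarrow> triple_poly q k \<in> R"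
    and P20: "120 * triple_poly q 20 - triple_poly q 10 ^ 2 \<in> R"
    and "i < 6"
  shows "z i \<in> R"
proof -
  note sum_unfold = triple_poly_def binconv_eval
  define f where "f = esym z {..<6}"
  have q0: "q 0 = 6"
    by (simp add: q_def)
  have newt: "of_nat (Suc k) * f (Suc k) = - (\<Sum>j\<le>k. f j * q (Suc k - j))" for k
    using newton[of "{..<6}" k z] by (simp add: f_def q_def)
  have f0: "f 0 = 1"
    by (simp add: f_def)
  have f1: "f 1 \<in> R"
    using newt[of 0] q1 minus by (simp add: f0)

  \<comment> \<open>A list serves as a sequence, since \<open>triple_poly\<close> in degree
    \<open>k\<close> reads only the entries up to \<open>k\<close>. Entries known to lie in
    \<open>R\<close> become 0, and a nonzero multiple of the unknown power sum remains.\<close>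
  have "triple_poly q 2 \<approx> triple_poly (nth [6, 0, q 2]) 2"
    by (rule eqv_triple_poly)
       (use q1 in \<open>auto simp: q0 le_Suc_eq eval_nat_numeral eqv_0_iff\<close>)
  also have "\<dots> = 36 * q 2"
    by (simp add: sum_unfold)
  finally have q2: "q 2 \<in> R"
    using P[of 2] eqv_mem numeral_cancel by blast
  have "2 * f 2 \<in> R"
    using newt[of 1] q1 q2 f1 by (simp add: f0 numeral_2_eq_2 diff minus mult)
  then have f2: "f 2 \<in> R"
    by (rule numeral_cancel)

  \<comment> \<open>\<open>q 3\<close> is still unknown, but in degree 4 it can only meet
    \<open>q 1\<close>.\<close>
  have "triple_poly q 4 \<approx> triple_poly (nth [6, 0, 0, q 3, q 4]) 4"
    by (rule eqv_triple_poly)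
       (use q1 q2 in \<open>auto simp: q0 le_Suc_eq eval_nat_numeral eqv_0_iff\<close>)
  also have "\<dots> = - (36 * q 4)"
    by (simp add: sum_unfold)
  finally have q4: "q 4 \<in> R"
    using P[of 4] eqv_mem numeral_cancel minus_iff by blast
  have "4 * f 4 = - (q 4 + f 1 * q 3 + f 2 * q 2 + f 3 * q 1)"
    using newt[of 3] by (simp add: f0 eval_nat_numeral)
  also have "\<dots> \<in> R"
    by (intro minus add) (simp_all add: mult mult' q1 q2 q4 f1 f2 del: One_nat_def)
  finally have f4: "f 4 \<in> R"
    by (rule numeral_cancel)
  have "q 3 - - (3 * f 3) = - (f 1 * q 2 + f 2 * q 1)"
    using newt[of 2] by (simp add: f0 eval_nat_numeral)
  also have "\<dots> \<in> R"
    by (intro minus add mult q1 q2)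
  finally have q3: "q 3 \<approx> - (3 * f 3)"
    by (simp add: eqv_def)
  have "q 5 - - (5 * f 5) = - (f 1 * q 4 + f 2 * q 3 + f 3 * q 2 + f 4 * q 1)"
    using newt[of 4] by (simp add: f0 eval_nat_numeral)
  also have "\<dots> \<in> R"
    by (intro minus add) (simp_all add: mult mult' q1 q2 q4 f1 f2 f4 del: One_nat_def)
  finally have q5: "q 5 \<approx> - (5 * f 5)"
    by (simp add: eqv_def)
  \<comment> \<open>Modulo \<open>R\<close> the \<open>z i\<close> are zeros of
    \<open>T^6 + f 3 T^3 + f 5 T + f 6\<close>. The parameters \<open>a\<close>, \<open>b\<close>,
    \<open>c\<close> insert values already computed.\<close>
  have rec: "q k \<approx> - (f 3 * a + f 5 * b + f 6 * c)"
    if "6 \<le> k" "q (k - 3) \<approx> a" "q (k - 5) \<approx> b" "q (k - 6) \<approx> c" for k a b c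
  proof -
    have "(\<Sum>j\<le>6. f j * q (k - j)) = 0"
      using newton_recurrence[of "{..<6}" k z] that(1) by (simp add: f_def q_def)
    then have "q k - - (f 3 * q (k - 3) + f 5 * q (k - 5) + f 6 * q (k - 6))
        = - (f 1 * q (k - 1) + f 2 * q (k - 2) + f 4 * q (k - 4))"
      by (simp add: f0 eval_nat_numeral algebra_simps eq_neg_iff_add_eq_0)
    also have "\<dots> \<in> R"
      by (intro minus add mult' f1 f2 f4)
    finally have "q k \<approx> - (f 3 * q (k - 3) + f 5 * q (k - 5) + f 6 * q (k - 6))"
      by (simp add: eqv_def)
    also have "\<dots> \<approx> - (f 3 * a + f 5 * b + f 6 * c)"
      by (intro eqv_minus eqv_add eqv_mult eqv_refl that)
    finally show ?thesis .
  qed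
  have q124: "q 1 \<approx> 0" "q 2 \<approx> 0" "q 4 \<approx> 0"
    using q1 q2 q4 by (simp_all add: eqv_0_iff)

  have "q 6 \<approx> - (f 3 * - (3 * f 3) + f 5 * 0 + f 6 * 6)"
    by (rule rec) (use q3 q124 q0 in simp_all)
  then have q6': "q 6 \<approx> 3 * f 3 ^ 2 - 6 * f 6"
    by (simp add: power2_eq_square algebra_simps)
  have "triple_poly q 6 \<approx> triple_poly (nth [6, 0, 0, - (3 * f 3), 0, - (5 * f 5), 3 * f 3 ^ 2 - 6 * f 6]) 6"
    by (rule eqv_triple_poly)
       (use q124 q3 q5 q6' in \<open>auto simp: q0 le_Suc_eq eval_nat_numeral\<close>)
  also have "\<dots> = 108 * (f 3 ^ 2 - 22 * f 6)"
    by (simp add: sum_unfold algebra_simps power2_eq_square)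
  \<comment> \<open>The relation of degree 6 is used below to trade squares of \<open>f 3\<close>
    for \<open>f 6\<close>.\<close>
  finally have f3: "f 3 ^ 2 \<approx> 22 * f 6"
    using P[of 6] eqv_mem numeral_cancel unfolding eqv_def by blast
  have "3 * f 3 ^ 2 - 6 * f 6 \<approx> 3 * (22 * f 6) - 6 * f 6"
    by (intro eqv_diff eqv_mult eqv_refl f3)
  with q6' have q6: "q 6 \<approx> 60 * f 6"
    by (auto dest: eqv_trans)
  have "q 7 \<approx> - (f 3 * 0 + f 5 * 0 + f 6 * 0)"
    by (rule rec) (use q124 in simp_all)
  then have q7: "q 7 \<approx> 0" by simp
  have "q 8 \<approx> - (f 3 * - (5 * f 5) + f 5 * - (3 * f 3) + f 6 * 0)"
    by (rule rec) (use q124 q3 q5 in simp_all)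
  then have q8: "q 8 \<approx> 8 * (f 3 * f 5)" by (simp add: algebra_simps)
  have "q 9 \<approx> - (f 3 * (60 * f 6) + f 5 * 0 + f 6 * - (3 * f 3))"
    by (rule rec) (use q124 q3 q6 in simp_all)
  then have q9: "q 9 \<approx> - (57 * (f 3 * f 6))" by (simp add: algebra_simps)
  have "q 10 \<approx> - (f 3 * 0 + f 5 * - (5 * f 5) + f 6 * 0)"
    by (rule rec) (use q124 q5 q7 in simp_all)
  then have q10: "q 10 \<approx> 5 * f 5 ^ 2" by (simp add: power2_eq_square algebra_simps)
  have "q 11 \<approx> - (f 3 * (8 * (f 3 * f 5)) + f 5 * (60 * f 6) + f 6 * - (5 * f 5))"
    by (rule rec) (use q5 q6 q8 in simp_all)
  also have "\<dots> = - (8 * f 5) * f 3 ^ 2 - 55 * (f 5 * f 6)"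
    by (simp add: power2_eq_square algebra_simps)
  also have "\<dots> \<approx> - (8 * f 5) * (22 * f 6) - 55 * (f 5 * f 6)"
    by (intro eqv_diff eqv_mult eqv_refl f3)
  finally have q11: "q 11 \<approx> - (231 * (f 5 * f 6))" by (simp add: algebra_simps)
  have "q 12 \<approx> - (f 3 * - (57 * (f 3 * f 6)) + f 5 * 0 + f 6 * (60 * f 6))"
    by (rule rec) (use q6 q7 q9 in simp_all)
  also have "\<dots> = 57 * f 6 * f 3 ^ 2 - 60 * f 6 ^ 2"
    by (simp add: power2_eq_square algebra_simps)
  also have "\<dots> \<approx> 57 * f 6 * (22 * f 6) - 60 * f 6 ^ 2"
    by (intro eqv_diff eqv_mult eqv_refl f3)
  finally have q12: "q 12 \<approx> 1194 * f 6 ^ 2" by (simp add: power2_eq_square algebra_simps)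

  \<comment> \<open>No monomial of weighted degree 12 in \<open>f 3\<close>, \<open>f 5\<close>,
    \<open>f 6\<close> contains \<open>f 5\<close>, so together with the relation for
    \<open>f 3 ^ 2\<close> this degree yields a multiple of \<open>f 6 ^ 2\<close>.\<close>
  have "triple_poly q 12 \<approx> triple_poly (nth [6, 0, 0, - (3 * f 3), 0, - (5 * f 5), 60 * f 6, 0,
      8 * (f 3 * f 5), - (57 * (f 3 * f 6)), 5 * f 5 ^ 2, - (231 * (f 5 * f 6)), 1194 * f 6 ^ 2]) 12"
    by (rule eqv_triple_poly)
       (use q124 q3 q5 q6 q7 q8 q9 q10 q11 q12 in \<open>auto simp: q0 le_Suc_eq numeral_eq_Suc\<close>)
  also have "\<dots> = 602363736 * f 6 ^ 2 - 27395280 * f 6 * f 3 ^ 2"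
    by (rule triple_poly_12)
  also have "\<dots> \<approx> 602363736 * f 6 ^ 2 - 27395280 * f 6 * (22 * f 6)"
    by (intro eqv_diff eqv_mult eqv_refl f3)
  \<comment> \<open>What counts is that \<open>602363736 - 22 * 27395280\<close> is not
    zero.\<close>
  also have "\<dots> = - (332424 * f 6 ^ 2)"
    by (simp add: power2_eq_square)
  finally have "f 6 ^ 2 \<in> R"
    using P[of 12] eqv_mem numeral_cancel minus_iff by blast
  then have f6: "f 6 \<in> R"
    by (rule root)
  then have "f 3 ^ 2 \<in> R"
    using eqv_mem[OF f3] mult by blast
  then have f3': "f 3 \<in> R"
    by (rule root)
  \<comment> \<open>With \<open>f 3\<close> and \<open>f 6\<close> in \<open>R\<close> the
    polynomial becomes \<open>T^6 + f 5 T\<close>: from index 1 on, a shift by 5 multiplies the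
    power sums by \<open>- f 5\<close>.\<close>
  have shift: "q k \<approx> - (f 5 * b)" if "6 \<le> k" "q (k - 5) \<approx> b" for k b
  proof -
    have "q k \<approx> - (f 3 * q (k - 3) + f 5 * b + f 6 * q (k - 6))"
      by (rule rec) (simp_all add: that)
    also have "\<dots> \<approx> - (0 + f 5 * b + 0)"
      by (intro eqv_minus eqv_add eqv_refl) (simp_all add: eqv_0_iff mult' f3' f6)
    finally show ?thesis by simp
  qed
  have q3': "q 3 \<in> R"
    using eqv_mem[OF q3] minus mult f3' by blast
  have mult5: "q (5 * Suc m) \<approx> 5 * (- f 5) ^ Suc m" for m
  proof (induction m)
    case 0
    then show ?case using q5 by simp
  next
    case (Suc m)
    have "q (5 * Suc (Suc m)) \<approx> - (f 5 * (5 * (- f 5) ^ Suc m))"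
      using Suc by (intro shift) simp_all
    then show ?case by (simp add: algebra_simps)
  qed
  have other: "q (5 * m + r) \<approx> 0" if "r \<in> {1, 2, 3, 4}" for m r
  proof (induction m)
    case 0
    then show ?case using that q124 q3' by (auto simp: eqv_0_iff)
  next
    case (Suc m)
    have "q (5 * Suc m + r) \<approx> - (f 5 * 0)"
      using Suc that by (intro shift) auto
    then show ?case by simp
  qed
  \<comment> \<open>The power sums of 0 and the five zeros of \<open>T^5 + f 5\<close>. Index 0 is
    set apart because there the zero element counts too, giving 6 instead of 5.\<close>
  define q' where "q' k = (if k = 0 then 6 else if k mod 5 = 0 then 5 * (- f 5) ^ (k div 5) else 0)" for k
  have q': "q k \<approx> q' k" for k
  proof (cases "k mod 5 = 0")
    case True
    then obtain m where "k = 5 * m" by auto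
    then show ?thesis using mult5[of "m - 1"] by (cases m) (simp_all add: q'_def q0)
  next
    case False
    then have "k mod 5 \<in> {1, 2, 3, 4}" by auto
    from other[OF this, of "k div 5"] False show ?thesis by (auto simp: q'_def)
  qed
  have "triple_poly q' 10 = 7380 * f 5 ^ 2" "triple_poly q' 20 = 907620 * f 5 ^ 4"
    by (rule triple_poly_10_20; auto simp: q'_def)+
  moreover have "120 * triple_poly q 20 - triple_poly q 10 ^ 2 \<approx> 120 * triple_poly q' 20 - triple_poly q' 10 ^ 2"
    by (intro eqv_diff eqv_mult eqv_power eqv_refl eqv_triple_poly q')
  \<comment> \<open>The coefficient is \<open>120 * 907620 - 7380 ^ 2\<close>; being nonzero, it
    forces \<open>f 5\<close> into \<open>R\<close>.\<close>
  ultimately have "120 * triple_poly q 20 - triple_poly q 10 ^ 2 \<approx> 54450000 * f 5 ^ 4"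
    by (simp add: power_mult_distrib flip: power_mult)
  then have "f 5 ^ 4 \<in> R"
    using P20 eqv_mem numeral_cancel minus_iff by blast
  then have f5: "f 5 \<in> R"
    by (rule root)
  have "q k \<in> R" if "1 \<le> k" "k \<le> 6" for k
  proof -
    have "k \<in> {1, 2, 3, 4, 5, 6}"
      using that by auto
    then show ?thesis
      using q1 q2 q3' q4 eqv_mem[OF q5] eqv_mem[OF q6] by (auto simp: minus mult f5 f6)
  qed
  then show ?thesis
    using power_sums_imp_mem[of "{..<6}" z i] \<open>i < 6\<close> by (simp add: q_def)
qed

end

section \<open>Enumerating the edges of the complete graph\<close>

lemma edges_eq_UN: "edges n = (\<Union>i\<in>{1..n}. (\<lambda>j. {i, j}) ` {i<..n})"
  unfolding edges_def by fastforce

lemma sum_edges: "(\<Sum>e\<in>edges n. f e) = (\<Sum>i=1..n. \<Sum>j\<in>{i<..n}. f {i, j})"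
proof -
  have "bij_betw (\<lambda>(i, j). {i, j}) (SIGMA i:{1..n}. {i<..n}) (edges n)"
    by (fastforce simp: bij_betw_def inj_on_def edges_def doubleton_eq_iff image_iff)
  from sum.reindex_bij_betw[OF this, of f, symmetric] show ?thesis
    by (simp add: sum.Sigma case_prod_unfold)
qed

lemma finite_edges: "finite (edges n)"
  by (rule finite_subset[of _ "Pow {..n}"]) (auto simp: edges_def)

lemma card_edges: "card (edges n) = (\<Sum>i=1..n. n - i)"
  using sum_edges[of "\<lambda>_. 1 :: nat" n] by simp

section \<open>Edge variables in the radical for three, four and five vertices\<close>

context radical_ideal
begin

lemma vertex_sums_mem:
  assumes "\<And>k. 1 \<le> k \<Longrightarrow> k \<le> n \<Longrightarrow> (\<Sum>i=1..n. (\<Sum>j\<in>{1..n} - {i}. x {i, j}) ^ k) \<in> R" "i \<in> {1..n}"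
  shows "(\<Sum>j\<in>{1..n} - {i}. x {i, j}) \<in> R"
  using power_sums_imp_mem[of "{1..n}" "\<lambda>i. \<Sum>j\<in>{1..n} - {i}. x {i, j}" i] assms by simp

lemma edges_mem_3:
  assumes vertex: "\<And>i. i \<in> {1..3::nat} \<Longrightarrow> (\<Sum>j\<in>{1..3} - {i}. x {i, j}) \<in> R"
    and "e \<in> edges 3"
  shows "x e \<in> R"
proof -
  define Y where "Y i = (\<Sum>j\<in>{1..3::nat} - {i}. x {i, j})" for i
  have Y: "Y i \<in> R" if "i \<in> {1, 2, 3}" for i
    using vertex[of i] that by (auto simp: Y_def)
  have intervals: "{1..3::nat} = {1, 2, 3}" "{1<..3::nat} = {2, 3}" "{2<..3::nat} = {3}" "{3<..3::nat} = {}"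
    by auto
  have sets: "{1..3::nat} - {1} = {2, 3}" "{1..3::nat} - {2} = {1, 3}" "{1..3::nat} - {3} = {1, 2}"
    by auto
  note Y_eqs = Y_def[of 1, unfolded sets] Y_def[of 2, unfolded sets] Y_def[of 3, unfolded sets]
  \<comment> \<open>In a triangle two vertex sums minus the third leave only the edge between the
    first two vertices, counted twice.\<close>
  have "2 * x {1, 2} = Y 1 + Y 2 - Y 3" "2 * x {1, 3} = Y 1 + Y 3 - Y 2" "2 * x {2, 3} = Y 2 + Y 3 - Y 1"
    by (simp_all add: Y_eqs insert_commute del: One_nat_def)
  then have "2 * x {1, 2} \<in> R" "2 * x {1, 3} \<in> R" "2 * x {2, 3} \<in> R"
    by (simp_all only: add diff Y insert_iff simp_thms)
  then have "x {1, 2} \<in> R" "x {1, 3} \<in> R" "x {2, 3} \<in> R"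
    by (blast intro: numeral_cancel)+
  moreover have "e \<in> {{1, 2}, {1, 3}, {2, 3}}"
    using assms(2) by (simp only: edges_eq_UN intervals Union_insert Union_empty image_insert image_empty
        Un_insert_left Un_empty_left Un_empty_right)
  ultimately show ?thesis by (auto simp del: One_nat_def)
qed

lemma edges_mem_4:
  assumes vertex: "\<And>i. i \<in> {1..4::nat} \<Longrightarrow> (\<Sum>j\<in>{1..4} - {i}. x {i, j}) \<in> R"
    and edge: "\<And>k. 2 \<le> k \<Longrightarrow> k \<le> 3 \<Longrightarrow> (\<Sum>i=1..4. \<Sum>j\<in>{i<..4}. x {i, j} ^ k) \<in> R"
    and "e \<in> edges 4"
  shows "x e \<in> R"
proof -
  define Y where "Y i = (\<Sum>j\<in>{1..4::nat} - {i}. x {i, j})" for i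
  have Y: "Y i \<in> R" if "i \<in> {1, 2, 3, 4}" for i
    using vertex[of i] that by (auto simp: Y_def)
  have sets: "{1..4::nat} - {1} = {2, 3, 4}" "{1..4::nat} - {2} = {1, 3, 4}"
    "{1..4::nat} - {3} = {1, 2, 4}" "{1..4::nat} - {4} = {1, 2, 3}"
    by auto
  note Y_eqs = Y_def[of 1, unfolded sets] Y_def[of 2, unfolded sets] Y_def[of 3, unfolded sets]
    Y_def[of 4, unfolded sets]
  \<comment> \<open>The four edges between \<open>{1, 2}\<close> and \<open>{3, 4}\<close> cancel,
    which leaves two opposite edges; the other two splittings are alike.\<close>
  have "2 * (x {3, 4} - x {1, 2}) = Y 3 + Y 4 - Y 1 - Y 2" "2 * (x {2, 4} - x {1, 3}) = Y 2 + Y 4 - Y 1 - Y 3"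
    "2 * (x {2, 3} - x {1, 4}) = Y 2 + Y 3 - Y 1 - Y 4"
    by (simp_all add: Y_eqs insert_commute del: One_nat_def)
  then have "2 * (x {3, 4} - x {1, 2}) \<in> R" "2 * (x {2, 4} - x {1, 3}) \<in> R" "2 * (x {2, 3} - x {1, 4}) \<in> R"
    by (simp_all only: add diff Y insert_iff simp_thms)
  then have opposite: "x {3, 4} \<approx> x {1, 2}" "x {2, 4} \<approx> x {1, 3}" "x {2, 3} \<approx> x {1, 4}"
    unfolding eqv_def by (blast intro: numeral_cancel)+
  \<comment> \<open>One representative for each of the three perfect matchings.\<close>
  define c where "c = nth [x {1, 2}, x {1, 3}, x {1, 4}]"
  have intervals: "{1..4::nat} = {1, 2, 3, 4}" "{1<..4::nat} = {2, 3, 4}" "{2<..4::nat} = {3, 4}"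
    "{3<..4::nat} = {4}" "{4<..4::nat} = {}"
    by auto
  have lt: "{..<3} = {0, 1, 2 :: nat}"
    by auto
  have "(\<Sum>i<3. c i ^ k) \<in> R" if "1 \<le> k" "k \<le> 3" for k
  \<comment> \<open>The hypothesis \<open>edge\<close> starts at degree 2; in degree 1 the sum of
    the three representatives is the vertex sum \<open>Y 1\<close>.\<close>
  proof (cases "k = 1")
    case True
    then show ?thesis
      using Y[of 1] by (simp add: lt c_def Y_eqs add.assoc del: One_nat_def)
  next
    case False
    have "(\<Sum>i=1..4. \<Sum>j\<in>{i<..4}. x {i, j} ^ k)
        = x {1, 2} ^ k + x {1, 3} ^ k + x {1, 4} ^ k + x {2, 3} ^ k + x {2, 4} ^ k + x {3, 4} ^ k"
      by (simp add: intervals add.assoc del: One_nat_def)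
    also have "\<dots> \<approx> x {1, 2} ^ k + x {1, 3} ^ k + x {1, 4} ^ k + x {1, 4} ^ k + x {1, 3} ^ k + x {1, 2} ^ k"
      by (intro eqv_add eqv_power eqv_refl opposite)
    also have "\<dots> = 2 * (\<Sum>i<3. c i ^ k)"
      by (simp add: lt c_def algebra_simps del: One_nat_def)
    finally have "2 * (\<Sum>i<3. c i ^ k) \<in> R"
      using eqv_mem edge[of k] that False by simp
    then show ?thesis
      by (rule numeral_cancel)
  qed
  then have "c i \<in> R" if "i < 3" for i
    using power_sums_imp_mem[of "{..<3}" c i] that by simp
  from this[of 0] this[of 1] this[of 2] have "x {1, 2} \<in> R" "x {1, 3} \<in> R" "x {1, 4} \<in> R"
    by (simp_all add: c_def)
  moreover from this have "x {3, 4} \<in> R" "x {2, 4} \<in> R" "x {2, 3} \<in> R"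
    by (simp_all only: opposite[THEN eqv_mem])
  moreover have "e \<in> {{1, 2}, {1, 3}, {1, 4}, {2, 3}, {2, 4}, {3, 4}}"
    using assms(3) by (simp only: edges_eq_UN intervals Union_insert Union_empty image_insert image_empty
        Un_insert_left Un_empty_left Un_empty_right)
  ultimately show ?thesis by (auto simp del: One_nat_def)
qed

lemma edges_mem_5:
  assumes vertex: "\<And>i. i \<in> {1..5::nat} \<Longrightarrow> (\<Sum>j\<in>{1..5} - {i}. x {i, j}) \<in> R"
    and edge: "\<And>k. 2 \<le> k \<Longrightarrow> k \<le> 6 \<Longrightarrow> (\<Sum>i=1..5. \<Sum>j\<in>{i<..5}. x {i, j} ^ k) \<in> R"
    and "e \<in> edges 5"
  shows "x e \<in> R"
proof -
  define Y where "Y i = (\<Sum>j\<in>{1..5::nat} - {i}. x {i, j})" for i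
  define y where "y i j = x {i, j}" for i j
  have Y: "Y i \<in> R" if "i \<in> {1, 2, 3, 4, 5}" for i
    using vertex[of i] that by (auto simp: Y_def)
  have sets: "{1..5::nat} - {1} = {2, 3, 4, 5}" "{1..5::nat} - {2} = {1, 3, 4, 5}"
    "{1..5::nat} - {3} = {1, 2, 4, 5}" "{1..5::nat} - {4} = {1, 2, 3, 5}" "{1..5::nat} - {5} = {1, 2, 3, 4}"
    by auto
  have Y_eqs: "Y 1 = y 1 2 + y 1 3 + y 1 4 + y 1 5" "Y 2 = y 1 2 + y 2 3 + y 2 4 + y 2 5"
    "Y 3 = y 1 3 + y 2 3 + y 3 4 + y 3 5" "Y 4 = y 1 4 + y 2 4 + y 3 4 + y 4 5"
    "Y 5 = y 1 5 + y 2 5 + y 3 5 + y 4 5"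
    unfolding Y_def sets y_def by (simp_all add: insert_commute add.assoc del: One_nat_def)
  define p where "p k = (\<Sum>e\<in>edges 5. x e ^ k)" for k
  have intervals: "{1..5::nat} = {1, 2, 3, 4, 5}" "{1<..5::nat} = {2, 3, 4, 5}" "{2<..5::nat} = {3, 4, 5}"
    "{3<..5::nat} = {4, 5}" "{4<..5::nat} = {5}" "{5<..5::nat} = {}"
    by auto
  have p: "p k = y 1 2 ^ k + y 1 3 ^ k + y 1 4 ^ k + y 1 5 ^ k + y 2 3 ^ k + y 2 4 ^ k + y 2 5 ^ k
      + y 3 4 ^ k + y 3 5 ^ k + y 4 5 ^ k" for k
    unfolding p_def sum_edges y_def
    by (simp add: intervals add.assoc del: One_nat_def)
  \<comment> \<open>Every edge is counted at both ends; this supplies the first power sum, which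
    \<open>edge\<close> omits.\<close>
  have "2 * p 1 = Y 1 + Y 2 + Y 3 + Y 4 + Y 5"
    by (simp add: p Y_eqs del: One_nat_def)
  also have "\<dots> \<in> R"
    by (simp only: add Y insert_iff simp_thms)
  finally have p1: "p 1 \<in> R"
    by (rule numeral_cancel)
  have p_small: "p k \<in> R" if "1 \<le> k" "k \<le> 6" for k
    using edge[of k] that p1 by (cases "k = 1") (simp_all add: p_def sum_edges)
  have card: "card (edges 5) = 10"
    by (simp add: card_edges intervals del: One_nat_def)
  have p12: "p 12 \<in> R" and p20: "10 * p 20 - p 10 ^ 2 \<in> R"
    using ten_power_sums[OF finite_edges card, of x] p_small by (simp_all add: p_def)

  \<comment> \<open>the sums over the pentagons in one orbit of the alternating group\<close>
  define z where "z = nth [y 1 2 + y 1 5 + y 2 3 + y 3 4 + y 4 5,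
    y 1 2 + y 1 3 + y 2 4 + y 3 5 + y 4 5,
    y 1 2 + y 1 4 + y 2 5 + y 3 4 + y 3 5,
    y 1 3 + y 1 4 + y 2 3 + y 2 5 + y 4 5,
    y 1 3 + y 1 5 + y 2 4 + y 2 5 + y 3 4,
    y 1 4 + y 1 5 + y 2 3 + y 2 4 + y 3 5]"
  have z: "z 0 = y 1 2 + y 1 5 + y 2 3 + y 3 4 + y 4 5" "z 1 = y 1 2 + y 1 3 + y 2 4 + y 3 5 + y 4 5"
      "z 2 = y 1 2 + y 1 4 + y 2 5 + y 3 4 + y 3 5" "z 3 = y 1 3 + y 1 4 + y 2 3 + y 2 5 + y 4 5"
     "z 4 = y 1 3 + y 1 5 + y 2 4 + y 2 5 + y 3 4" "z 5 = y 1 4 + y 1 5 + y 2 3 + y 2 4 + y 3 5"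
    by (simp_all add: z_def)
  define q where "q k = (\<Sum>a<6. z a ^ k)" for k
  \<comment> \<open>Each block consists of the three pentagons through one edge. Edges disjoint from
    it lie on two of them and adjacent edges on one; the sums at the three vertices off the edge
    count in the same way.\<close>
  have blocks: "z 0 + z 1 + z 2 - 3 * y 1 2 = Y 3 + Y 4 + Y 5"
    "z 1 + z 3 + z 4 - 3 * y 1 3 = Y 2 + Y 4 + Y 5"
    "z 2 + z 3 + z 5 - 3 * y 1 4 = Y 2 + Y 3 + Y 5"
    "z 0 + z 4 + z 5 - 3 * y 1 5 = Y 2 + Y 3 + Y 4"
    "z 0 + z 3 + z 5 - 3 * y 2 3 = Y 1 + Y 4 + Y 5"
    "z 1 + z 4 + z 5 - 3 * y 2 4 = Y 1 + Y 3 + Y 5"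
    "z 2 + z 3 + z 4 - 3 * y 2 5 = Y 1 + Y 3 + Y 4"
    "z 0 + z 2 + z 4 - 3 * y 3 4 = Y 1 + Y 2 + Y 5"
    "z 1 + z 2 + z 5 - 3 * y 3 5 = Y 1 + Y 2 + Y 4"
    "z 0 + z 1 + z 3 - 3 * y 4 5 = Y 1 + Y 2 + Y 3"
    unfolding z Y_eqs by (simp_all only: algebra_simps, simp_all)
  \<comment> \<open>Every edge lies on three of the six pentagons, so the complementary triple meets
    disjoint edges once and adjacent ones twice. The sums at the two ends together with
    \<open>p 1\<close> count these equally, and the edge itself three times.\<close>
  have coblocks: "z 3 + z 4 + z 5 - - (3 * y 1 2) = Y 1 + Y 2 + p 1"
    "z 0 + z 2 + z 5 - - (3 * y 1 3) = Y 1 + Y 3 + p 1"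
    "z 0 + z 1 + z 4 - - (3 * y 1 4) = Y 1 + Y 4 + p 1"
    "z 1 + z 2 + z 3 - - (3 * y 1 5) = Y 1 + Y 5 + p 1"
    "z 1 + z 2 + z 4 - - (3 * y 2 3) = Y 2 + Y 3 + p 1"
    "z 0 + z 2 + z 3 - - (3 * y 2 4) = Y 2 + Y 4 + p 1"
    "z 0 + z 1 + z 5 - - (3 * y 2 5) = Y 2 + Y 5 + p 1"
    "z 1 + z 3 + z 5 - - (3 * y 3 4) = Y 3 + Y 4 + p 1"
    "z 0 + z 3 + z 4 - - (3 * y 3 5) = Y 3 + Y 5 + p 1"
    "z 2 + z 4 + z 5 - - (3 * y 4 5) = Y 4 + Y 5 + p 1"
    unfolding z Y_eqs p by (simp_all only: algebra_simps, simp_all)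
  have eqv_blocks: "z 0 + z 1 + z 2 \<approx> 3 * y 1 2"
    "z 1 + z 3 + z 4 \<approx> 3 * y 1 3"
    "z 2 + z 3 + z 5 \<approx> 3 * y 1 4"
    "z 0 + z 4 + z 5 \<approx> 3 * y 1 5"
    "z 0 + z 3 + z 5 \<approx> 3 * y 2 3"
    "z 1 + z 4 + z 5 \<approx> 3 * y 2 4"
    "z 2 + z 3 + z 4 \<approx> 3 * y 2 5"
    "z 0 + z 2 + z 4 \<approx> 3 * y 3 4"
    "z 1 + z 2 + z 5 \<approx> 3 * y 3 5"
    "z 0 + z 1 + z 3 \<approx> 3 * y 4 5"
    "z 3 + z 4 + z 5 \<approx> - (3 * y 1 2)"
    "z 0 + z 2 + z 5 \<approx> - (3 * y 1 3)"
    "z 0 + z 1 + z 4 \<approx> - (3 * y 1 4)"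
    "z 1 + z 2 + z 3 \<approx> - (3 * y 1 5)"
    "z 1 + z 2 + z 4 \<approx> - (3 * y 2 3)"
    "z 0 + z 2 + z 3 \<approx> - (3 * y 2 4)"
    "z 0 + z 1 + z 5 \<approx> - (3 * y 2 5)"
    "z 1 + z 3 + z 5 \<approx> - (3 * y 3 4)"
    "z 0 + z 3 + z 4 \<approx> - (3 * y 3 5)"
    "z 2 + z 4 + z 5 \<approx> - (3 * y 4 5)"
    unfolding eqv_def blocks coblocks by (simp_all only: add Y p1 insert_iff simp_thms)
  \<comment> \<open>For even \<open>k\<close> the signs of the complementary triples disappear, so
    each edge contributes twice; with the six orderings this gives the factor 12.\<close>
  have P: "triple_poly q k \<approx> 12 * (3 ^ k * p k)" if "even k" for k
  proof -
    have "triple_poly q k \<approx> 6 * ((3 * y 1 2) ^ k + (- (3 * y 1 2)) ^ k + (3 * y 1 3) ^ k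
        + (- (3 * y 1 3)) ^ k + (3 * y 1 4) ^ k + (- (3 * y 1 4)) ^ k + (3 * y 1 5) ^ k + (- (3 * y 1 5)) ^ k
        + (3 * y 2 3) ^ k + (- (3 * y 2 3)) ^ k + (3 * y 2 4) ^ k + (- (3 * y 2 4)) ^ k + (3 * y 2 5) ^ k
        + (- (3 * y 2 5)) ^ k + (3 * y 3 4) ^ k + (- (3 * y 3 4)) ^ k + (3 * y 3 5) ^ k + (- (3 * y 3 5)) ^ k
        + (3 * y 4 5) ^ k + (- (3 * y 4 5)) ^ k)"
      unfolding q_def triple_poly_blocks by (intro eqv_mult eqv_add eqv_power eqv_refl eqv_blocks)
    also have "\<dots> = 12 * (3 ^ k * p k)"
      using that by (simp add: p power_mult_distrib algebra_simps)
    finally show ?thesis .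
  qed
  have "q 1 = 3 * p 1"
  proof -
    have "{..<6} = {0, 1, 2, 3, 4, 5 :: nat}"
      by auto
    then show ?thesis
      unfolding q_def p by (simp add: z algebra_simps del: One_nat_def)
  qed
  then have "q 1 \<in> R"
    using mult p1 by simp
  moreover have "triple_poly q k \<in> R" if "k \<in> {2, 4, 6, 12}" for k
    using that eqv_mem[OF P[of k]] p_small p12 by (auto intro!: mult)
  \<comment> \<open>Since \<open>120 = 10 * 12\<close>, both terms acquire the factor
    \<open>144 * 3 ^ 20\<close> after \<open>P\<close>, and the relation from
    \<open>ten_power_sums\<close> remains.\<close>
  moreover have "120 * triple_poly q 20 - triple_poly q 10 ^ 2 \<in> R"
  proof -
    have "120 * triple_poly q 20 - triple_poly q 10 ^ 2
        \<approx> 120 * (12 * (3 ^ 20 * p 20)) - (12 * (3 ^ 10 * p 10)) ^ 2"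
      by (intro eqv_diff eqv_mult eqv_power eqv_refl P) simp_all
    also have "\<dots> = 144 * 3 ^ 20 * (10 * p 20 - p 10 ^ 2)"
      by (simp add: power2_eq_square algebra_simps)
    finally show ?thesis
      using eqv_mem mult p20 by blast
  qed
  ultimately have z_mem: "z i \<in> R" if "i < 6" for i
    using six_power_sums[of z i] that unfolding q_def by blast
  have "3 * y 1 2 \<in> R" "3 * y 1 3 \<in> R" "3 * y 1 4 \<in> R" "3 * y 1 5 \<in> R" "3 * y 2 3 \<in> R"
      "3 * y 2 4 \<in> R" "3 * y 2 5 \<in> R" "3 * y 3 4 \<in> R" "3 * y 3 5 \<in> R" "3 * y 4 5 \<in> R"
    using eqv_blocks(1-10)[THEN eqv_mem, THEN iffD1] by (simp_all add: add z_mem)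
  from this[THEN numeral_cancel] have "x {1, 2} \<in> R" "x {1, 3} \<in> R" "x {1, 4} \<in> R"
      "x {1, 5} \<in> R" "x {2, 3} \<in> R" "x {2, 4} \<in> R" "x {2, 5} \<in> R" "x {3, 4} \<in> R"
      "x {3, 5} \<in> R" "x {4, 5} \<in> R"
    by (simp_all only: y_def)
  moreover have "e \<in> {{1, 2}, {1, 3}, {1, 4}, {1, 5}, {2, 3}, {2, 4}, {2, 5}, {3, 4}, {3, 5}, {4, 5}}"
    using assms(3) by (simp only: edges_eq_UN intervals Union_insert Union_empty image_insert image_empty
        Un_insert_left Un_empty_left Un_empty_right)
  ultimately show ?thesis by (auto simp del: One_nat_def)
qed

end

section \<open>Substitution, group action and Reynolds operator\<close>

lemma poly_eq_sum_single:
  "p = (\<Sum>m\<in>Poly_Mapping.keys p. Poly_Mapping.single m (Poly_Mapping.lookup p m))"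
  by (rule poly_mapping_eqI) (auto simp: lookup_sum lookup_single when_def in_keys_iff)

lemma mult_eq_sum_single:
  "p * q = (\<Sum>m\<in>Poly_Mapping.keys p. \<Sum>m'\<in>Poly_Mapping.keys q.
     Poly_Mapping.single (m + m') (Poly_Mapping.lookup p m * Poly_Mapping.lookup q m'))"
  by (subst poly_eq_sum_single[of p], subst poly_eq_sum_single[of q]) (simp add: sum_product mult_single)

lemma Const_0 [simp]: "Const 0 = 0"
  by (simp add: Const_def)

lemma Const_1 [simp]: "Const 1 = 1"
  by (simp add: Const_def)

lemma Const_add: "Const (a + b) = Const a + Const b"
  by (simp add: Const_def single_add)

lemma Const_mult: "Const (a * b) = Const a * Const b"
  by (simp add: Const_def mult_single)

lemma Const_of_nat: "Const (of_nat k) = of_nat k"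
  by (simp add: Const_def)

lemma Const_eq_iff [simp]: "Const a = Const b \<longleftrightarrow> a = b"
  by (metis Const_def lookup_single_eq)

lemma Const_power: "Const (a ^ k) = Const a ^ k"
  by (induction k) (simp_all add: Const_mult)

lemma Const_mult_single: "Const c * Poly_Mapping.single m a = Poly_Mapping.single m (c * a)"
  by (simp add: Const_def mult_single)

lemma Var_power: "Var e ^ k = Poly_Mapping.single (Poly_Mapping.single e k) 1"
  by (induction k) (simp_all add: Var_def mult_single flip: single_add)

definition mono_eval :: "(nat set \<Rightarrow> 'a::comm_monoid_mult) \<Rightarrow> (nat set \<Rightarrow>\<^sub>0 nat) \<Rightarrow> 'a" where
  "mono_eval f m = (\<Prod>e\<in>Poly_Mapping.keys m. f e ^ Poly_Mapping.lookup m e)"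

text \<open>Exponents outside the support are 0 and give factors 1, so several monomials can be
  compared over a common finite set of variables.\<close>

lemma mono_eval_superset:
  "finite E \<Longrightarrow> Poly_Mapping.keys m \<subseteq> E \<Longrightarrow> mono_eval f m = (\<Prod>e\<in>E. f e ^ Poly_Mapping.lookup m e)"
  unfolding mono_eval_def by (rule prod.mono_neutral_left) (auto simp: in_keys_iff)

lemma mono_eval_add: "mono_eval f (m + m') = mono_eval f m * mono_eval f m'"
proof -
  define E where "E = Poly_Mapping.keys m \<union> Poly_Mapping.keys m'"
  have "finite E" "Poly_Mapping.keys m \<subseteq> E" "Poly_Mapping.keys m' \<subseteq> E" "Poly_Mapping.keys (m + m') \<subseteq> E"
    using keys_add[of m m'] by (auto simp: E_def)
  then show ?thesis
    by (simp add: mono_eval_superset lookup_add power_add prod.distrib)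
qed

lemma subst_superset:
  assumes "finite M" "Poly_Mapping.keys p \<subseteq> M"
  shows "subst f p = (\<Sum>m\<in>M. Const (Poly_Mapping.lookup p m) * mono_eval f m)"
  unfolding subst_def mono_eval_def using assms by (intro sum.mono_neutral_left) (auto simp: in_keys_iff)

lemma subst_single: "subst f (Poly_Mapping.single m c) = Const c * mono_eval f m"
  by (subst subst_superset[of "{m}"]) auto

lemma subst_0 [simp]: "subst f 0 = 0"
  by (simp add: subst_def)

lemma subst_add: "subst f (p + q) = subst f p + subst f q"
proof -
  define M where "M = Poly_Mapping.keys p \<union> Poly_Mapping.keys q"
  have "finite M" "Poly_Mapping.keys p \<subseteq> M" "Poly_Mapping.keys q \<subseteq> M" "Poly_Mapping.keys (p + q) \<subseteq> M"
    using keys_add[of p q] by (auto simp: M_def)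
  then show ?thesis
    by (simp add: subst_superset lookup_add Const_add distrib_right sum.distrib)
qed

lemma subst_sum: "subst f (\<Sum>i\<in>I. p i) = (\<Sum>i\<in>I. subst f (p i))"
  by (induction I rule: infinite_finite_induct) (simp_all add: subst_add)

lemma subst_mult: "subst f (p * q) = subst f p * subst f q"
proof -
  have "subst f (p * q) = (\<Sum>m\<in>Poly_Mapping.keys p. \<Sum>m'\<in>Poly_Mapping.keys q.
      Const (Poly_Mapping.lookup p m) * mono_eval f m * (Const (Poly_Mapping.lookup q m') * mono_eval f m'))"
    by (simp add: mult_eq_sum_single[of p q] subst_sum subst_single Const_mult mono_eval_add mult_ac)
  also have "\<dots> = subst f p * subst f q"
    by (simp add: subst_superset[OF finite_keys order_refl] sum_product)
  finally show ?thesis .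
qed

lemma subst_Const [simp]: "subst f (Const c) = Const c"
  by (simp add: Const_def[of c] subst_single mono_eval_def)

lemma subst_Var [simp]: "subst f (Var e) = f e"
  by (simp add: Var_def subst_single mono_eval_def)

lemma subst_1 [simp]: "subst f 1 = 1"
  using subst_Const[of f 1] by simp

lemma subst_power: "subst f (p ^ k) = subst f p ^ k"
  by (induction k) (simp_all add: subst_mult)

lemma subst_prod: "subst f (\<Prod>i\<in>I. p i) = (\<Prod>i\<in>I. subst f (p i))"
  by (induction I rule: infinite_finite_induct) (simp_all add: subst_mult)

lemma subst_mono_eval: "subst f (mono_eval g m) = mono_eval (\<lambda>e. subst f (g e)) m"
  by (simp add: mono_eval_def subst_prod subst_power)

text \<open>Both sides are algebra homomorphisms in \<open>p\<close> that agree on the variables.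
  For renamings of variables this makes \<open>act\<close> compatible with composition.\<close>

lemma subst_subst: "subst f (subst g p) = subst (\<lambda>e. subst f (g e)) p"
  by (simp add: subst_superset[OF finite_keys[of p] order_refl] subst_sum subst_mult subst_mono_eval)

lemma mono_eval_Var: "mono_eval Var m = (Poly_Mapping.single m 1 :: 'k::comm_ring_1 graph_poly)"
proof -
  have "(\<Prod>e\<in>E. Poly_Mapping.single (g e) (1::'k)) = Poly_Mapping.single (\<Sum>e\<in>E. g e) 1"
    for E :: "nat set set" and g :: "nat set \<Rightarrow> nat set \<Rightarrow>\<^sub>0 nat"
    by (induction E rule: infinite_finite_induct) (simp_all add: mult_single)
  then show ?thesis
    by (simp add: mono_eval_def Var_power flip: poly_eq_sum_single)
qed

lemma subst_Var_id: "subst Var p = p"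
  by (subst (2) poly_eq_sum_single[of p])
     (simp add: subst_superset[OF finite_keys order_refl] mono_eval_Var Const_mult_single)

lemma subst_cong:
  assumes "p \<in> poly_ring n" "\<And>e. e \<in> edges n \<Longrightarrow> f e = g e"
  shows "subst f p = subst g p"
proof -
  have "f e = g e" if "m \<in> Poly_Mapping.keys p" "e \<in> Poly_Mapping.keys m" for m e
    using assms(1) that by (intro assms(2)) (auto simp: poly_ring_def)
  then show ?thesis
    unfolding subst_def by simp
qed

lemma Const_in_poly_ring: "Const c \<in> poly_ring n"
  by (simp add: poly_ring_def Const_def)

lemma zero_in_poly_ring: "0 \<in> poly_ring n"
  unfolding Const_0[symmetric] by (rule Const_in_poly_ring)

lemma one_in_poly_ring: "1 \<in> poly_ring n"
  unfolding Const_1[symmetric] by (rule Const_in_poly_ring)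

lemma Var_in_poly_ring: "e \<in> edges n \<Longrightarrow> Var e \<in> poly_ring n"
  by (simp add: poly_ring_def Var_def)

lemma add_in_poly_ring: "p \<in> poly_ring n \<Longrightarrow> q \<in> poly_ring n \<Longrightarrow> p + q \<in> poly_ring n"
  using keys_add[of p q] unfolding poly_ring_def by blast

lemma mult_in_poly_ring: "p \<in> poly_ring n \<Longrightarrow> q \<in> poly_ring n \<Longrightarrow> p * q \<in> poly_ring n"
proof -
  assume p: "p \<in> poly_ring n" and q: "q \<in> poly_ring n"
  have "Poly_Mapping.keys m \<subseteq> edges n" if m: "m \<in> Poly_Mapping.keys (p * q)" for m
  proof -
    obtain a b where "m = a + b" "a \<in> Poly_Mapping.keys p" "b \<in> Poly_Mapping.keys q"
      using keys_mult[of p q] m by blast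
    then show ?thesis
      using keys_add[of a b] p q by (auto simp: poly_ring_def)
  qed
  then show ?thesis
    by (simp add: poly_ring_def)
qed

lemma sum_in_poly_ring: "(\<And>i. i \<in> I \<Longrightarrow> p i \<in> poly_ring n) \<Longrightarrow> (\<Sum>i\<in>I. p i) \<in> poly_ring n"
  by (induction I rule: infinite_finite_induct) (simp_all add: zero_in_poly_ring add_in_poly_ring)

lemma power_in_poly_ring: "p \<in> poly_ring n \<Longrightarrow> p ^ k \<in> poly_ring n"
  by (induction k) (simp_all add: one_in_poly_ring mult_in_poly_ring)

lemma prod_in_poly_ring: "(\<And>i. i \<in> I \<Longrightarrow> p i \<in> poly_ring n) \<Longrightarrow> (\<Prod>i\<in>I. p i) \<in> poly_ring n"
  by (induction I rule: infinite_finite_induct) (simp_all add: one_in_poly_ring mult_in_poly_ring)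

lemma subst_in_poly_ring:
  assumes "\<And>e. e \<in> (\<Union>m\<in>Poly_Mapping.keys p. Poly_Mapping.keys m) \<Longrightarrow> f e \<in> poly_ring n"
  shows "subst f p \<in> poly_ring n"
  unfolding subst_def using assms
  by (intro sum_in_poly_ring mult_in_poly_ring Const_in_poly_ring prod_in_poly_ring power_in_poly_ring) auto

lemma permutes_image_edges:
  assumes "\<sigma> permutes {1..n}" "e \<in> edges n"
  shows "\<sigma> ` e \<in> edges n"
proof -
  obtain i j where e: "e = {i, j}" "1 \<le> i" "i < j" "j \<le> n"
    using assms(2) by (auto simp: edges_def)
  then have "\<sigma> i \<in> {1..n}" "\<sigma> j \<in> {1..n}"
    using permutes_in_image[OF assms(1)] by auto
  moreover have "\<sigma> i \<noteq> \<sigma> j"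
    using inj_eq[OF permutes_inj[OF assms(1)], of i j] e by simp
  then consider "\<sigma> i < \<sigma> j" | "\<sigma> j < \<sigma> i"
    by linarith
  then have "\<exists>a b. \<sigma> ` e = {a, b} \<and> 1 \<le> a \<and> a < b \<and> b \<le> n"
  proof cases
    case 1
    with calculation show ?thesis
      by (intro exI[of _ "\<sigma> i"] exI[of _ "\<sigma> j"]) (simp add: e)
  next
    case 2
    with calculation show ?thesis
      by (intro exI[of _ "\<sigma> j"] exI[of _ "\<sigma> i"]) (simp add: e insert_commute)
  qed
  then show ?thesis
    by (simp add: edges_def)
qed

lemma act_add: "act \<sigma> (p + q) = act \<sigma> p + act \<sigma> q"
  by (simp add: act_def subst_add)

lemma act_mult: "act \<sigma> (p * q) = act \<sigma> p * act \<sigma> q"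
  by (simp add: act_def subst_mult)

lemma act_sum: "act \<sigma> (\<Sum>i\<in>I. p i) = (\<Sum>i\<in>I. act \<sigma> (p i))"
  by (simp add: act_def subst_sum)

lemma act_power: "act \<sigma> (p ^ k) = act \<sigma> p ^ k"
  by (simp add: act_def subst_power)

lemma act_Const [simp]: "act \<sigma> (Const c) = Const c"
  by (simp add: act_def)

lemma act_act: "act \<sigma> (act \<tau> p) = act (\<sigma> \<circ> \<tau>) p"
  by (simp add: act_def subst_subst image_comp)

lemma act_in_poly_ring:
  assumes "\<sigma> permutes {1..n}" "p \<in> poly_ring n"
  shows "act \<sigma> p \<in> poly_ring n"
  unfolding act_def using assms(2)
  by (intro subst_in_poly_ring Var_in_poly_ring permutes_image_edges[OF assms(1)]) (auto simp: poly_ring_def)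

lemma Const_in_invariants: "Const c \<in> invariants n"
  by (simp add: invariants_def Const_in_poly_ring)

lemma add_in_invariants: "p \<in> invariants n \<Longrightarrow> q \<in> invariants n \<Longrightarrow> p + q \<in> invariants n"
  by (simp add: invariants_def add_in_poly_ring act_add)

lemma mult_in_invariants: "p \<in> invariants n \<Longrightarrow> q \<in> invariants n \<Longrightarrow> p * q \<in> invariants n"
  by (simp add: invariants_def mult_in_poly_ring act_mult)

lemma sum_in_invariants: "(\<And>i. i \<in> I \<Longrightarrow> p i \<in> invariants n) \<Longrightarrow> (\<Sum>i\<in>I. p i) \<in> invariants n"
  by (induction I rule: infinite_finite_induct) (use Const_in_invariants[of 0 n] in \<open>simp_all add: add_in_invariants\<close>)

lemma adjoin_in_invariants: "p \<in> adjoin S \<Longrightarrow> S \<subseteq> invariants n \<Longrightarrow> p \<in> invariants n"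
  by (induction rule: adjoin.induct)
     (auto simp: Const_in_invariants add_in_invariants mult_in_invariants)

definition reynolds :: "nat \<Rightarrow> 'k::field_char_0 graph_poly \<Rightarrow> 'k graph_poly" where
  "reynolds n p = Const (1 / fact n) * (\<Sum>\<sigma> | \<sigma> permutes {1..n}. act \<sigma> p)"

lemma reynolds_sum: "reynolds n (\<Sum>i\<in>I. p i) = (\<Sum>i\<in>I. reynolds n (p i))"
  unfolding reynolds_def act_sum by (subst sum.swap) (simp add: sum_distrib_left)

text \<open>Linearity over the invariants is what carries generators of \<open>poly_ring n\<close>
  over \<open>adjoin S\<close> to generators of \<open>invariants n\<close>.\<close>

lemma reynolds_mult: "a \<in> invariants n \<Longrightarrow> reynolds n (a * p) = a * reynolds n p"
  by (simp add: reynolds_def act_mult invariants_def sum_distrib_left mult_ac)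

lemma reynolds_invariant:
  assumes "p \<in> invariants n"
  shows "reynolds n p = p"
proof -
  have "reynolds n p = Const (1 / fact n) * (of_nat (fact n) * p)"
    using assms by (simp add: reynolds_def invariants_def card_permutations)
  also have "\<dots> = Const (1 / fact n * of_nat (fact n)) * p"
    by (simp only: Const_mult Const_of_nat mult.assoc)
  finally show ?thesis by simp
qed

text \<open>Composition with a fixed permutation only reorders the sum over the group.\<close>

lemma reynolds_in_invariants:
  assumes "p \<in> poly_ring n"
  shows "reynolds n p \<in> invariants n"
proof -
  have "act \<sigma> (reynolds n p) = reynolds n p" if \<sigma>: "\<sigma> permutes {1..n}" for \<sigma>
  proof -
    have "act \<sigma> (reynolds n p) = Const (1 / fact n) * (\<Sum>\<tau> | \<tau> permutes {1..n}. act (\<sigma> \<circ> \<tau>) p)"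
      by (simp add: reynolds_def act_mult act_sum act_act)
    also have "\<dots> = reynolds n p"
      unfolding reynolds_def using setum_permutations_compose_left[OF \<sigma>, of "\<lambda>\<tau>. act \<tau> p"] by simp
    finally show ?thesis .
  qed
  moreover have "reynolds n p \<in> poly_ring n"
    unfolding reynolds_def
    by (intro mult_in_poly_ring Const_in_poly_ring sum_in_poly_ring act_in_poly_ring assms) auto
  ultimately show ?thesis
    by (simp add: invariants_def)
qed

section \<open>Finite generation from nilpotence of the variables\<close>

definition mono_degree :: "(nat set \<Rightarrow>\<^sub>0 nat) \<Rightarrow> nat" where
  "mono_degree m = (\<Sum>e\<in>Poly_Mapping.keys m. Poly_Mapping.lookup m e)"

lemma mono_degree_superset:
  "finite E \<Longrightarrow> Poly_Mapping.keys m \<subseteq> E \<Longrightarrow> mono_degree m = (\<Sum>e\<in>E. Poly_Mapping.lookup m e)"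
  unfolding mono_degree_def by (rule sum.mono_neutral_left) (auto simp: in_keys_iff)

lemma mono_degree_add: "mono_degree (m + m') = mono_degree m + mono_degree m'"
proof -
  define E where "E = Poly_Mapping.keys m \<union> Poly_Mapping.keys m'"
  have "finite E" "Poly_Mapping.keys m \<subseteq> E" "Poly_Mapping.keys m' \<subseteq> E" "Poly_Mapping.keys (m + m') \<subseteq> E"
    using keys_add[of m m'] by (auto simp: E_def)
  then show ?thesis
    by (simp add: mono_degree_superset lookup_add sum.distrib)
qed

text \<open>A variant of \<open>homogeneous\<close> with visible degree, since the reduction of
  monomials below compares degrees and wants them positive. The zero polynomial has every degree
  here.\<close>

definition homogeneous_of_degree :: "nat \<Rightarrow> 'k::zero graph_poly \<Rightarrow> bool" where
  "homogeneous_of_degree d p \<longleftrightarrow> (\<forall>m\<in>Poly_Mapping.keys p. mono_degree m = d)"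

lemma homogeneous_of_degree_imp_homogeneous: "homogeneous_of_degree d p \<Longrightarrow> homogeneous p"
  by (auto simp: homogeneous_def homogeneous_of_degree_def mono_degree_def)

lemma homogeneous_of_degree_Var: "homogeneous_of_degree 1 (Var e)"
  by (simp add: homogeneous_of_degree_def Var_def mono_degree_def)

lemma homogeneous_of_degree_add:
  "homogeneous_of_degree d p \<Longrightarrow> homogeneous_of_degree d q \<Longrightarrow> homogeneous_of_degree d (p + q)"
  using keys_add[of p q] unfolding homogeneous_of_degree_def by blast

lemma homogeneous_of_degree_sum:
  "(\<And>i. i \<in> I \<Longrightarrow> homogeneous_of_degree d (p i)) \<Longrightarrow> homogeneous_of_degree d (\<Sum>i\<in>I. p i)"
  by (induction I rule: infinite_finite_induct)
     (simp_all add: homogeneous_of_degree_add, simp_all add: homogeneous_of_degree_def)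

lemma homogeneous_of_degree_mult:
  assumes "homogeneous_of_degree d p" "homogeneous_of_degree d' q"
  shows "homogeneous_of_degree (d + d') (p * q)"
  unfolding homogeneous_of_degree_def
proof
  fix m assume "m \<in> Poly_Mapping.keys (p * q)"
  then obtain a b where "m = a + b" "a \<in> Poly_Mapping.keys p" "b \<in> Poly_Mapping.keys q"
    using keys_mult[of p q] by blast
  then show "mono_degree m = d + d'"
    using assms by (simp add: homogeneous_of_degree_def mono_degree_add)
qed

lemma homogeneous_of_degree_power:
  "homogeneous_of_degree d p \<Longrightarrow> homogeneous_of_degree (k * d) (p ^ k)"
proof (induction k)
  case 0
  then show ?case by (simp add: homogeneous_of_degree_def mono_degree_def)
next
  case (Suc k)
  then show ?case using homogeneous_of_degree_mult[of d p "k * d"] by simp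
qed

definition hom_component :: "nat \<Rightarrow> 'k::comm_ring_1 graph_poly \<Rightarrow> 'k graph_poly" where
  "hom_component d p = (\<Sum>m | m \<in> Poly_Mapping.keys p \<and> mono_degree m = d.
     Poly_Mapping.single m (Poly_Mapping.lookup p m))"

lemma lookup_hom_component:
  "Poly_Mapping.lookup (hom_component d p) m = (if mono_degree m = d then Poly_Mapping.lookup p m else 0)"
proof -
  have "finite {m. m \<in> Poly_Mapping.keys p \<and> mono_degree m = d}"
    by (rule finite_subset[of _ "Poly_Mapping.keys p"]) auto
  then show ?thesis
    by (auto simp: hom_component_def lookup_sum lookup_single when_def in_keys_iff)
qed

lemma keys_hom_component: "Poly_Mapping.keys (hom_component d p) = {m \<in> Poly_Mapping.keys p. mono_degree m = d}"
  by (auto simp: in_keys_iff lookup_hom_component split: if_splits)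

lemma hom_component_add: "hom_component d (p + q) = hom_component d p + hom_component d q"
  by (rule poly_mapping_eqI) (simp add: lookup_hom_component lookup_add)

lemma hom_component_sum: "hom_component d (\<Sum>i\<in>I. p i) = (\<Sum>i\<in>I. hom_component d (p i))"
proof -
  have "hom_component d 0 = 0"
    by (simp add: hom_component_def)
  then show ?thesis
    by (induction I rule: infinite_finite_induct) (simp_all add: hom_component_add)
qed

lemma hom_component_single:
  "hom_component d (Poly_Mapping.single m c) = (if mono_degree m = d then Poly_Mapping.single m c else 0)"
  by (rule poly_mapping_eqI) (simp add: lookup_hom_component lookup_single when_def)

lemma hom_component_mult:
  assumes "homogeneous_of_degree d' q"
  shows "hom_component (d + d') (p * q) = hom_component d p * q"
proof -
  have "hom_component (d + d') (p * q) = (\<Sum>m\<in>Poly_Mapping.keys p. \<Sum>m'\<in>Poly_Mapping.keys q.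
      if mono_degree m = d then Poly_Mapping.single (m + m') (Poly_Mapping.lookup p m * Poly_Mapping.lookup q m') else 0)"
    unfolding mult_eq_sum_single[of p q] hom_component_sum hom_component_single
    using assms by (intro sum.cong refl) (simp add: mono_degree_add homogeneous_of_degree_def)
  also have "\<dots> = (\<Sum>m\<in>Poly_Mapping.keys p. if mono_degree m = d then
      (\<Sum>m'\<in>Poly_Mapping.keys q. Poly_Mapping.single (m + m') (Poly_Mapping.lookup p m * Poly_Mapping.lookup q m')) else 0)"
    by (intro sum.cong refl) simp
  also have "\<dots> = (\<Sum>m\<in>Poly_Mapping.keys (hom_component d p). \<Sum>m'\<in>Poly_Mapping.keys q.
      Poly_Mapping.single (m + m') (Poly_Mapping.lookup (hom_component d p) m * Poly_Mapping.lookup q m'))"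
    by (simp add: keys_hom_component lookup_hom_component sum.inter_filter)
  also have "\<dots> = hom_component d p * q"
    by (rule mult_eq_sum_single[symmetric])
  finally show ?thesis .
qed

lemma hom_component_mult_eq_0:
  assumes "homogeneous_of_degree d' q" "d < d'"
  shows "hom_component d (p * q) = 0"
  unfolding mult_eq_sum_single[of p q] hom_component_sum hom_component_single
  using assms by (intro sum.neutral ballI) (auto simp: mono_degree_add homogeneous_of_degree_def)

lemma hom_component_in_poly_ring: "p \<in> poly_ring n \<Longrightarrow> hom_component d p \<in> poly_ring n"
  by (simp add: poly_ring_def keys_hom_component)

section \<open>Spans, ideals and radicals\<close>

definition subsemiring :: "'a::comm_ring_1 set \<Rightarrow> bool" where
  "subsemiring A \<longleftrightarrow> 0 \<in> A \<and> 1 \<in> A \<and> (\<forall>a\<in>A. \<forall>b\<in>A. a + b \<in> A \<and> a * b \<in> A)"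

lemma subsemiring_UNIV: "subsemiring UNIV"
  by (simp add: subsemiring_def)

text \<open>The shape is that of \<open>finitely_generated_over\<close>. Taking
  \<open>A = UNIV\<close> gives ideals and \<open>A = adjoin S\<close> modules over the parameters,
  so both share the closure lemmas.\<close>

definition span_over :: "'a::comm_ring_1 set \<Rightarrow> 'a set \<Rightarrow> 'a set" where
  "span_over A B = {\<Sum>b\<in>B. c b * b | c. \<forall>b\<in>B. c b \<in> A}"

lemma span_over_add:
  assumes "subsemiring A" "p \<in> span_over A B" "q \<in> span_over A B"
  shows "p + q \<in> span_over A B"
proof -
  obtain c d where "p = (\<Sum>b\<in>B. c b * b)" "q = (\<Sum>b\<in>B. d b * b)"
      "\<forall>b\<in>B. c b \<in> A" "\<forall>b\<in>B. d b \<in> A"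
    using assms by (auto simp: span_over_def)
  then have "p + q = (\<Sum>b\<in>B. (c b + d b) * b)" "\<forall>b\<in>B. c b + d b \<in> A"
    using assms(1) by (simp_all add: distrib_right sum.distrib subsemiring_def)
  then show ?thesis
    unfolding span_over_def by (intro CollectI exI[of _ "\<lambda>b. c b + d b"]) simp
qed

lemma span_over_mult:
  assumes "subsemiring A" "a \<in> A" "p \<in> span_over A B"
  shows "a * p \<in> span_over A B"
proof -
  obtain c where "p = (\<Sum>b\<in>B. c b * b)" "\<forall>b\<in>B. c b \<in> A"
    using assms by (auto simp: span_over_def)
  then have "a * p = (\<Sum>b\<in>B. (a * c b) * b)" "\<forall>b\<in>B. a * c b \<in> A"
    using assms(1,2) by (simp_all add: sum_distrib_left mult.assoc subsemiring_def)
  then show ?thesis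
    unfolding span_over_def by (intro CollectI exI[of _ "\<lambda>b. a * c b"]) simp
qed

lemma span_over_0: "subsemiring A \<Longrightarrow> 0 \<in> span_over A B"
  unfolding span_over_def by (intro CollectI exI[of _ "\<lambda>_. 0"]) (simp add: subsemiring_def)

lemma span_over_sum:
  "subsemiring A \<Longrightarrow> (\<And>i. i \<in> I \<Longrightarrow> f i \<in> span_over A B) \<Longrightarrow> (\<Sum>i\<in>I. f i) \<in> span_over A B"
  by (induction I rule: infinite_finite_induct) (simp_all add: span_over_0 span_over_add)

lemma span_over_base:
  assumes "subsemiring A" "finite B" "b \<in> B"
  shows "b \<in> span_over A B"
proof -
  have "b = (\<Sum>t\<in>B. (if t = b then 1 else 0) * t)"
    using assms by (simp add: if_distrib[of "\<lambda>x. x * _"] cong: if_cong)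
  then show ?thesis
    using assms(1) unfolding span_over_def
    by (intro CollectI exI[of _ "\<lambda>t. if t = b then 1 else 0"]) (simp add: subsemiring_def)
qed

abbreviation ideal_of :: "'a::comm_ring_1 set \<Rightarrow> 'a set" where
  "ideal_of \<equiv> span_over UNIV"

lemmas ideal_of_mult = span_over_mult[OF subsemiring_UNIV UNIV_I]
  and ideal_of_0 = span_over_0[OF subsemiring_UNIV]
  and ideal_of_sum = span_over_sum[OF subsemiring_UNIV]

definition radical_of :: "'a::comm_ring_1 set \<Rightarrow> 'a set" where
  "radical_of S = {p. \<exists>N. p ^ N \<in> ideal_of S}"

text \<open>In the binomial expansion with exponent \<open>M + N\<close> every term contains
  \<open>a ^ M\<close> or \<open>b ^ N\<close>.\<close>

lemma radical_of_add:
  assumes "a \<in> radical_of S" "b \<in> radical_of S"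
  shows "a + b \<in> radical_of S"
proof -
  obtain M N where M: "a ^ M \<in> ideal_of S" and N: "b ^ N \<in> ideal_of S"
    using assms by (auto simp: radical_of_def)
  have "of_nat (M + N choose i) * a ^ i * b ^ (M + N - i) \<in> ideal_of S" if "i \<le> M + N" for i
  proof (cases "M \<le> i")
    case True
    then have "a ^ i = a ^ (i - M) * a ^ M"
      by (simp flip: power_add)
    then have "of_nat (M + N choose i) * a ^ i * b ^ (M + N - i)
        = (of_nat (M + N choose i) * a ^ (i - M) * b ^ (M + N - i)) * a ^ M"
      by (simp add: mult_ac)
    then show ?thesis
      using ideal_of_mult[OF M] by simp
  next
    case False
    then have "b ^ (M + N - i) = b ^ (M - i) * b ^ N"
      by (simp flip: power_add)
    then have "of_nat (M + N choose i) * a ^ i * b ^ (M + N - i)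
        = (of_nat (M + N choose i) * a ^ i * b ^ (M - i)) * b ^ N"
      by (simp add: mult_ac)
    then show ?thesis
      using ideal_of_mult[OF N] by simp
  qed
  then have "(a + b) ^ (M + N) \<in> ideal_of S"
    unfolding binomial_ring by (intro ideal_of_sum) simp
  then show ?thesis
    by (auto simp: radical_of_def)
qed

lemma radical_ideal_radical_of: "radical_ideal (radical_of (S :: 'k::field_char_0 graph_poly set))"
proof
  have mult: "c * a \<in> radical_of S" if "a \<in> radical_of S" for a c
    using that ideal_of_mult by (auto simp: radical_of_def power_mult_distrib)
  show "0 \<in> radical_of S"
    unfolding radical_of_def using ideal_of_0[of S] by (auto intro!: exI[of _ 1])
  show "a + b \<in> radical_of S" if "a \<in> radical_of S" "b \<in> radical_of S" for a b
    using that by (rule radical_of_add)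
  show "c * a \<in> radical_of S" if "a \<in> radical_of S" for a c
    using that by (rule mult)
  show "a \<in> radical_of S" if "a ^ k \<in> radical_of S" for a k
    using that by (auto simp: radical_of_def simp flip: power_mult)
  show "a \<in> radical_of S" if "of_nat k * a \<in> radical_of S" "k \<noteq> 0" for k a
  proof -
    have "Const (1 / of_nat k) * (of_nat k * a) = Const (1 / of_nat k * of_nat k) * a"
      by (simp only: Const_mult Const_of_nat mult.assoc)
    also have "\<dots> = a"
      using that(2) by simp
    finally show ?thesis
      using mult[OF that(1)] by metis
  qed
qed

lemma zero_in_adjoin: "0 \<in> adjoin S"
  unfolding Const_0[symmetric] by (rule adjoin.const)

lemma one_in_adjoin: "1 \<in> adjoin S"
  unfolding Const_1[symmetric] by (rule adjoin.const)

lemma subsemiring_adjoin: "subsemiring (adjoin S)"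
  by (simp add: subsemiring_def zero_in_adjoin one_in_adjoin adjoin.add adjoin.mult)

text \<open>The ideal is formed with coefficients from the whole type. Sending all variables outside
  \<open>edges n\<close> to 0 is a retraction onto \<open>poly_ring n\<close> that fixes
  \<open>p\<close> and \<open>S\<close>, so it may be applied to the coefficients.\<close>

lemma ideal_of_poly_ring_coeffs:
  assumes "p \<in> ideal_of S" "p \<in> poly_ring n" "S \<subseteq> poly_ring n"
  shows "\<exists>c. p = (\<Sum>s\<in>S. c s * s) \<and> (\<forall>s. c s \<in> poly_ring n)"
proof -
  define \<pi> :: "'a graph_poly \<Rightarrow> 'a graph_poly"
    where "\<pi> = subst (\<lambda>e. if e \<in> edges n then Var e else 0)"
  have id: "\<pi> q = q" if "q \<in> poly_ring n" for q
    using subst_cong[OF that, of "\<lambda>e. if e \<in> edges n then Var e else 0" Var] by (simp add: \<pi>_def subst_Var_id)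
  obtain c where c: "p = (\<Sum>s\<in>S. c s * s)"
    using assms(1) by (auto simp: span_over_def)
  have "p = \<pi> p"
    using id assms(2) by simp
  also have "\<dots> = (\<Sum>s\<in>S. \<pi> (c s) * \<pi> s)"
    by (simp add: c \<pi>_def subst_sum subst_mult)
  also have "\<dots> = (\<Sum>s\<in>S. \<pi> (c s) * s)"
    using id assms(3) by (intro sum.cong) auto
  finally have p: "p = (\<Sum>s\<in>S. \<pi> (c s) * s)" .
  have "\<pi> (c s) \<in> poly_ring n" for s
    unfolding \<pi>_def by (rule subst_in_poly_ring) (simp add: Var_in_poly_ring zero_in_poly_ring)
  with p show ?thesis
    by (intro exI[of _ "\<lambda>s. \<pi> (c s)"]) simp
qed

definition bounded_monos :: "nat \<Rightarrow> nat \<Rightarrow> 'k::zero_neq_one graph_poly set" where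
  "bounded_monos n N = (\<lambda>m. Poly_Mapping.single m 1) `
     {m. Poly_Mapping.keys m \<subseteq> edges n \<and> (\<forall>e. Poly_Mapping.lookup m e \<le> N)}"

lemma finite_bounded_monos: "finite (bounded_monos n N)"
proof -
  have "finite {f :: nat set \<Rightarrow> nat. \<forall>e. (e \<in> edges n \<longrightarrow> f e \<in> {..N}) \<and> (e \<notin> edges n \<longrightarrow> f e = 0)}"
    using finite_edges by (intro finite_set_of_finite_funs) auto
  moreover have "Poly_Mapping.lookup ` {m. Poly_Mapping.keys m \<subseteq> edges n \<and> (\<forall>e. Poly_Mapping.lookup m e \<le> N)}
      \<subseteq> {f. \<forall>e. (e \<in> edges n \<longrightarrow> f e \<in> {..N}) \<and> (e \<notin> edges n \<longrightarrow> f e = 0)}"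
    by (auto simp: in_keys_iff)
  ultimately have "finite {m. Poly_Mapping.keys m \<subseteq> edges n \<and> (\<forall>e. Poly_Mapping.lookup m e \<le> N)}"
    by (metis (no_types, lifting) finite_imageD finite_subset inj_onI poly_mapping_eqI)
  then show ?thesis
    by (simp add: bounded_monos_def)
qed

lemma bounded_monos_in_poly_ring: "bounded_monos n N \<subseteq> poly_ring n"
  by (auto simp: bounded_monos_def poly_ring_def)

text \<open>Graded Nakayama lemma: comparing homogeneous components makes the cofactors in \<open>x\<^sub>e\<^sup>N \<in> (S)\<close>
  of smaller degree than the monomial that is being reduced.\<close>

lemma poly_ring_subset_adjoin_span:
  fixes S :: "'k::comm_ring_1 graph_poly set"
  assumes S: "finite S" "S \<subseteq> poly_ring n"
    and homog: "\<And>s. s \<in> S \<Longrightarrow> homogeneous_of_degree (\<delta> s) s"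
        "\<And>s. s \<in> S \<Longrightarrow> 0 < \<delta> s"
    and nilp: "\<And>e. e \<in> edges n \<Longrightarrow> Var e ^ N \<in> ideal_of S"
  shows "poly_ring n \<subseteq> span_over (adjoin S) (bounded_monos n N)"
proof -
  define M where "M = span_over (adjoin S) (bounded_monos n N :: 'k graph_poly set)"
  have mono: "Poly_Mapping.single m 1 \<in> M" if "Poly_Mapping.keys m \<subseteq> edges n" for m
    using that
  proof (induction "mono_degree m" arbitrary: m rule: less_induct)
    case less
    \<comment> \<open>The induction hypothesis, extended by linearity from monomials to homogeneous
      polynomials of smaller degree.\<close>
    have lower: "q \<in> M" if "q \<in> poly_ring n" "homogeneous_of_degree d q" "d < mono_degree m" for q d
    proof -
      have "Const (Poly_Mapping.lookup q m') * Poly_Mapping.single m' 1 \<in> M" if "m' \<in> Poly_Mapping.keys q" for m'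
        unfolding M_def
      proof (intro span_over_mult[OF subsemiring_adjoin] adjoin.const less(1)[unfolded M_def])
        show "mono_degree m' < mono_degree m"
          using that \<open>homogeneous_of_degree d q\<close> \<open>d < mono_degree m\<close> by (simp add: homogeneous_of_degree_def)
        show "Poly_Mapping.keys m' \<subseteq> edges n"
          using that \<open>q \<in> poly_ring n\<close> by (simp add: poly_ring_def)
      qed
      then show ?thesis
        unfolding M_def by (subst poly_eq_sum_single) (auto intro!: span_over_sum[OF subsemiring_adjoin] simp: Const_mult_single)
    qed
    show ?case
    proof (cases "\<forall>e. Poly_Mapping.lookup m e \<le> N")
      case True
      then show ?thesis
        unfolding M_def using less.prems finite_bounded_monos
        by (intro span_over_base[OF subsemiring_adjoin]) (auto simp: bounded_monos_def)
    next
      case False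
      then obtain e where e: "N < Poly_Mapping.lookup m e"
        by (auto simp: not_le)
      define m' where "m' = m - Poly_Mapping.single e N"
      have m: "m = Poly_Mapping.single e N + m'"
        by (rule poly_mapping_eqI) (use e in \<open>auto simp: m'_def lookup_add lookup_minus lookup_single when_def\<close>)
      have "e \<in> edges n"
        using e less.prems by (auto simp: in_keys_iff)
      then have "Var e ^ N \<in> ideal_of S" "Var e ^ N \<in> poly_ring n"
        by (simp_all add: nilp Var_in_poly_ring power_in_poly_ring)
      then obtain c where c: "Var e ^ N = (\<Sum>s\<in>S. c s * s)" "\<And>s. c s \<in> poly_ring n"
        using ideal_of_poly_ring_coeffs[OF _ _ S(2)] by blast
      have m'_ring: "Poly_Mapping.single m' (1::'k) \<in> poly_ring n"
      proof -
        have "Poly_Mapping.keys m' \<subseteq> Poly_Mapping.keys m"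
          by (auto simp: in_keys_iff m'_def lookup_minus)
        with less.prems show ?thesis by (simp add: poly_ring_def)
      qed
      have "Poly_Mapping.single m (1::'k) = Var e ^ N * Poly_Mapping.single m' 1"
        by (simp add: Var_power mult_single m)
      also have "\<dots> = (\<Sum>s\<in>S. c s * Poly_Mapping.single m' 1 * s)"
        unfolding c(1) sum_distrib_right by (intro sum.cong refl) (simp add: mult_ac)
      \<comment> \<open>The \<open>c s\<close> are not known to be homogeneous; passing to the
        component in the degree of \<open>m\<close> selects the right part of each.\<close>
      finally have "hom_component (mono_degree m) (Poly_Mapping.single m (1::'k))
          = hom_component (mono_degree m) (\<Sum>s\<in>S. c s * Poly_Mapping.single m' 1 * s)"
        by (rule arg_cong)
      then have "Poly_Mapping.single m 1 = (\<Sum>s\<in>S. hom_component (mono_degree m) (c s * Poly_Mapping.single m' 1 * s))"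
        by (simp add: hom_component_single hom_component_sum)
      also have "\<dots> \<in> M"
        unfolding M_def
      proof (rule span_over_sum[OF subsemiring_adjoin], fold M_def)
        fix s assume s: "s \<in> S"
        define p where "p = c s * Poly_Mapping.single m' 1"
        have p: "p \<in> poly_ring n"
          by (simp add: p_def mult_in_poly_ring c(2) m'_ring)
        show "hom_component (mono_degree m) (c s * Poly_Mapping.single m' 1 * s) \<in> M"
        \<comment> \<open>Outside this case the truncated difference
          \<open>mono_degree m - \<delta> s\<close> is the true one, and positivity of
          \<open>\<delta> s\<close> makes the degree drop.\<close>
        proof (cases "mono_degree m < \<delta> s")
          case True
          then show ?thesis
            using hom_component_mult_eq_0[OF homog(1)[OF s]] by (simp add: M_def span_over_0[OF subsemiring_adjoin])
        next
          case False
          define d where "d = mono_degree m - \<delta> s"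
          have d: "mono_degree m = d + \<delta> s" "d < mono_degree m"
            using False homog(2)[OF s] by (simp_all add: d_def)
          have "hom_component d p \<in> M"
            by (rule lower[OF hom_component_in_poly_ring[OF p] _ d(2)])
               (simp add: homogeneous_of_degree_def keys_hom_component)
          then have "s * hom_component d p \<in> M"
            unfolding M_def by (intro span_over_mult[OF subsemiring_adjoin] adjoin.gen s)
          then show ?thesis
            unfolding d(1) p_def[symmetric] hom_component_mult[OF homog(1)[OF s]] by (simp add: mult.commute)
        qed
      qed
      finally show ?thesis .
    qed
  qed
  show ?thesis
  proof
    fix p :: "'k graph_poly" assume p: "p \<in> poly_ring n"
    have "Const (Poly_Mapping.lookup p m) * Poly_Mapping.single m 1 \<in> M" if "m \<in> Poly_Mapping.keys p" for m
      using mono[of m] p that unfolding M_def by (auto intro!: span_over_mult[OF subsemiring_adjoin] adjoin.const simp: poly_ring_def)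
    then show "p \<in> span_over (adjoin S) (bounded_monos n N)"
      unfolding M_def by (subst poly_eq_sum_single) (auto intro!: span_over_sum[OF subsemiring_adjoin] simp: Const_mult_single)
  qed
qed

text \<open>An invariant is first written over \<open>adjoin S\<close> in bounded monomials.
  Averaging fixes the invariant and the coefficients, and turns the monomials into
  invariants.\<close>

lemma invariants_finitely_generated:
  fixes S :: "'k::field_char_0 graph_poly set"
  assumes S: "finite S" "S \<subseteq> invariants n"
    and homog: "\<And>s. s \<in> S \<Longrightarrow> \<exists>d>0. homogeneous_of_degree d s"
    and rad: "\<And>e. e \<in> edges n \<Longrightarrow> Var e \<in> radical_of S"
  shows "finitely_generated_over (adjoin S) (invariants n)"
proof -
  obtain N where N: "\<And>e. e \<in> edges n \<Longrightarrow> Var e ^ N e \<in> ideal_of S"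
    using rad unfolding radical_of_def by (simp only: mem_Collect_eq) metis
  obtain \<delta> where \<delta>: "\<And>s. s \<in> S \<Longrightarrow> homogeneous_of_degree (\<delta> s) s"
      "\<And>s. s \<in> S \<Longrightarrow> 0 < \<delta> s"
    using homog by metis
  \<comment> \<open>A single exponent that serves all variables, as the sum bounds each
    \<open>N e\<close>.\<close>
  define K where "K = (\<Sum>e\<in>edges n. N e)"
  have nilp: "Var e ^ K \<in> ideal_of S" if "e \<in> edges n" for e
  proof -
    have "N e \<le> K"
      unfolding K_def using that finite_edges by (intro member_le_sum) auto
    then have "Var e ^ K = Var e ^ (K - N e) * Var e ^ N e"
      by (simp flip: power_add)
    then show ?thesis
      using ideal_of_mult[OF N[OF that]] by metis
  qed
  have ring: "S \<subseteq> poly_ring n"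
    using S(2) by (auto simp: invariants_def)
  define B :: "'k graph_poly set" where "B = reynolds n ` bounded_monos n K"
  have "finite B"
    by (simp add: B_def finite_bounded_monos)
  have "B \<subseteq> invariants n"
    unfolding B_def using bounded_monos_in_poly_ring reynolds_in_invariants by blast
  have "span_over (adjoin S) B \<subseteq> invariants n"
    unfolding span_over_def using adjoin_in_invariants[OF _ S(2)] \<open>B \<subseteq> invariants n\<close>
    by (auto intro!: sum_in_invariants mult_in_invariants)
  moreover have "invariants n \<subseteq> span_over (adjoin S) B"
  proof
    fix p :: "'k graph_poly" assume p: "p \<in> invariants n"
    then have "p \<in> span_over (adjoin S) (bounded_monos n K)"
      using poly_ring_subset_adjoin_span[OF S(1) ring \<delta> nilp] by (auto simp: invariants_def)
    then obtain c where c: "p = (\<Sum>b\<in>bounded_monos n K. c b * b)"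
        "\<And>b. b \<in> bounded_monos n K \<Longrightarrow> c b \<in> adjoin S"
      by (auto simp: span_over_def)
    have "p = reynolds n p"
      using p by (simp add: reynolds_invariant)
    also have "\<dots> = (\<Sum>b\<in>bounded_monos n K. c b * reynolds n b)"
      using c(2) adjoin_in_invariants[OF _ S(2)] by (simp add: c(1) reynolds_sum reynolds_mult)
    \<comment> \<open>Different monomials may have the same average, so membership is shown term by
      term instead of reindexing the sum by \<open>B\<close>.\<close>
    also have "\<dots> \<in> span_over (adjoin S) B"
      using c(2) \<open>finite B\<close> by (intro span_over_sum[OF subsemiring_adjoin] span_over_mult[OF subsemiring_adjoin] span_over_base[OF subsemiring_adjoin]) (auto simp: B_def)
    finally show "p \<in> span_over (adjoin S) B" .
  qed
  ultimately have "invariants n = span_over (adjoin S) B"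
    by (rule antisym[rotated])
  then show ?thesis
    unfolding finitely_generated_over_def span_over_def
    using \<open>finite B\<close> \<open>B \<subseteq> invariants n\<close> by blast
qed

section \<open>The system of parameters\<close>

lemma edge_power_sum_eq: "edge_power_sum n k = (\<Sum>e\<in>edges n. Var e ^ k)"
  by (simp add: edge_power_sum_def sum_edges)

lemma doubleton_in_edges: "i \<in> {1..n} \<Longrightarrow> j \<in> {1..n} - {i} \<Longrightarrow> {i, j} \<in> edges n"
  by (cases i j rule: linorder_cases) (auto simp: edges_def insert_commute)

text \<open>A permutation of the vertices permutes the edges, hence the summands.\<close>

lemma edge_power_sum_in_invariants: "edge_power_sum n k \<in> invariants n"
proof -
  have "act \<sigma> (edge_power_sum n k) = (edge_power_sum n k :: 'a graph_poly)" if \<sigma>: "\<sigma> permutes {1..n}" for \<sigma>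
  proof -
    have inj: "inj_on (image \<sigma>) (edges n)"
      using permutes_inj[OF \<sigma>] by (meson inj_image_eq_iff inj_onI)
    moreover have "image \<sigma> ` edges n = edges n"
      using permutes_image_edges[OF \<sigma>] by (intro endo_inj_surj finite_edges inj) auto
    ultimately have "bij_betw (image \<sigma>) (edges n) (edges n)"
      by (simp add: bij_betw_def)
    from sum.reindex_bij_betw[OF this, of "\<lambda>e. Var e ^ k :: 'a graph_poly"] show ?thesis
      by (simp add: edge_power_sum_eq act_sum act_power) (simp add: act_def)
  qed
  then show ?thesis
    unfolding invariants_def
    by (auto simp: edge_power_sum_eq intro!: sum_in_poly_ring power_in_poly_ring Var_in_poly_ring)
qed

lemma act_X:
  assumes "\<sigma> permutes {1..n}"
  shows "act \<sigma> (X n i) = X n (\<sigma> i)"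
proof -
  have "bij_betw \<sigma> ({1..n} - {i}) ({1..n} - {\<sigma> i})"
    using assms permutes_inj[OF assms] permutes_image[OF assms]
    by (auto simp: bij_betw_def inj_on_def inj_def image_set_diff)
  from sum.reindex_bij_betw[OF this, of "\<lambda>j. Var {\<sigma> i, j}"] show ?thesis
    by (simp add: X_def act_sum act_Var)
qed

lemma vertex_power_sum_in_invariants: "vertex_power_sum n k \<in> invariants n"
proof -
  have "act \<sigma> (vertex_power_sum n k) = (vertex_power_sum n k :: 'a graph_poly)" if "\<sigma> permutes {1..n}" for \<sigma>
    using sum.permute[OF that, of "\<lambda>i. X n i ^ k :: 'a graph_poly", symmetric] that
    by (simp add: vertex_power_sum_def act_sum act_power act_X comp_def)
  then show ?thesis
    unfolding invariants_def vertex_power_sum_def X_def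
    by (auto intro!: sum_in_poly_ring power_in_poly_ring Var_in_poly_ring doubleton_in_edges)
qed

lemma homogeneous_edge_power_sum: "homogeneous_of_degree k (edge_power_sum n k)"
  unfolding edge_power_sum_eq
  using homogeneous_of_degree_power[OF homogeneous_of_degree_Var] by (intro homogeneous_of_degree_sum) simp

lemma homogeneous_vertex_power_sum: "homogeneous_of_degree k (vertex_power_sum n k)"
  unfolding vertex_power_sum_def X_def
  using homogeneous_of_degree_power[OF homogeneous_of_degree_sum[OF homogeneous_of_degree_Var]]
  by (intro homogeneous_of_degree_sum) simp

section \<open>Distinctness of the parameters\<close>

definition eval12 :: "'k::comm_ring_1 \<Rightarrow> 'k graph_poly \<Rightarrow> 'k graph_poly" where
  "eval12 t = subst (\<lambda>e. if e = {1, 2} then Const t else 0)"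

lemma eval12_edge_power_sum:
  assumes "2 \<le> n" "1 \<le> k"
  shows "eval12 t (edge_power_sum n k) = Const (t ^ k)"
proof -
  have "{1, 2} \<in> edges n"
    using assms(1) unfolding edges_def by fastforce
  then show ?thesis
    using assms(2) finite_edges[of n]
    by (simp add: eval12_def edge_power_sum_eq subst_sum subst_power Const_power if_distrib[of "\<lambda>x. x ^ k"]
        power_0_left cong: if_cong)
qed

lemma eval12_vertex_power_sum:
  assumes "2 \<le> n" "1 \<le> k"
  shows "eval12 t (vertex_power_sum n k) = Const (2 * t ^ k)"
proof -
  have X: "eval12 t (X n i) = (if i = 1 \<or> i = 2 then Const t else 0)" if "i \<in> {1..n}" for i
  proof -
    have "eval12 t (X n i) = (\<Sum>j\<in>{1..n} - {i}. if i = 1 \<and> j = 2 \<or> i = 2 \<and> j = 1 then Const t else 0)"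
      by (simp add: eval12_def X_def subst_sum doubleton_eq_iff)
    \<comment> \<open>For \<open>i\<close> equal to 1 or 2 the other endpoint is
      \<open>3 - i\<close>; writing it as a function of \<open>i\<close> leaves a sum with at most
      one nonzero term.\<close>
    also have "\<dots> = (\<Sum>j\<in>{1..n} - {i}. if j = 3 - i \<and> (i = 1 \<or> i = 2) then Const t else 0)"
      by (intro sum.cong) auto
    also have "\<dots> = (if i = 1 \<or> i = 2 then Const t else 0)"
      using assms(1) by auto
    finally show ?thesis .
  qed
  have "eval12 t (vertex_power_sum n k) = (\<Sum>i=1..n. eval12 t (X n i) ^ k)"
    by (simp add: vertex_power_sum_def eval12_def subst_sum subst_power)
  also have "\<dots> = (\<Sum>i\<in>{1..n}. if i \<in> {1, 2} then Const t ^ k else 0)"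
    using assms(2) by (intro sum.cong refl) (simp add: X zero_power)
  also have "\<dots> = (\<Sum>i\<in>{1, 2::nat}. Const t ^ k)"
    using assms(1) by (intro sum.mono_neutral_cong_right) auto
  also have "\<dots> = Const (t ^ k) + Const (t ^ k)"
    by (simp add: Const_power flip: mult_2)
  also have "\<dots> = Const (2 * t ^ k)"
    by (simp only: mult_2 Const_add)
  finally show ?thesis .
qed

text \<open>The parameters are given as a set, so their number depends on their being distinct.
  Under \<open>eval12 t\<close> they become \<open>t ^ k\<close> and \<open>2 * t ^ k\<close>: the
  value 2 separates the degrees within a family, the value 1 separates the families.\<close>

lemma card_parameters:
  assumes "2 \<le> n"
  shows "card ({edge_power_sum n k | k. 2 \<le> k \<and> k \<le> m} \<union>
    {vertex_power_sum n k | k. 1 \<le> k \<and> k \<le> n} :: 'k::field_char_0 graph_poly set) = (m - 1) + n"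
proof -
  have two: "k = l" if "(2::'k) ^ k = 2 ^ l" for k l :: nat
  proof -
    have "of_nat (2 ^ k) = (of_nat (2 ^ l) :: 'k)"
      using that by simp
    then show ?thesis
      by (simp only: of_nat_eq_iff power_inject_exp)
  qed
  have "inj_on (edge_power_sum n :: nat \<Rightarrow> 'k graph_poly) {2..m}"
  proof (rule inj_onI)
    fix k l assume kl: "k \<in> {2..m}" "l \<in> {2..m}" "edge_power_sum n k = (edge_power_sum n l :: 'k graph_poly)"
    have "Const (2 ^ k :: 'k) = Const (2 ^ l)"
      using arg_cong[OF kl(3), of "eval12 2"] kl(1,2) assms by (simp add: eval12_edge_power_sum)
    then show "k = l" using two by simp
  qed
  moreover have "inj_on (vertex_power_sum n :: nat \<Rightarrow> 'k graph_poly) {1..n}"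
  proof (rule inj_onI)
    fix k l assume kl: "k \<in> {1..n}" "l \<in> {1..n}" "vertex_power_sum n k = (vertex_power_sum n l :: 'k graph_poly)"
    have "Const (2 * 2 ^ k :: 'k) = Const (2 * 2 ^ l)"
      using arg_cong[OF kl(3), of "eval12 2"] kl(1,2) assms by (simp add: eval12_vertex_power_sum)
    then show "k = l" using two by simp
  qed
  moreover have "(edge_power_sum n ` {2..m} \<inter> vertex_power_sum n ` {1..n} :: 'k graph_poly set) = {}"
  proof -
    have "edge_power_sum n k \<noteq> (vertex_power_sum n l :: 'k graph_poly)" if "2 \<le> k" "1 \<le> l" for k l
    proof
      assume "edge_power_sum n k = (vertex_power_sum n l :: 'k graph_poly)"
      from arg_cong[OF this, of "eval12 1"] have "Const (1::'k) = Const 2"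
        using that assms by (simp add: eval12_edge_power_sum eval12_vertex_power_sum del: Const_1)
      then show False by (simp del: Const_1)
    qed
    then show ?thesis by auto
  qed
  moreover have "{edge_power_sum n k | k. 2 \<le> k \<and> k \<le> m} = (edge_power_sum n ` {2..m} :: 'k graph_poly set)"
    "{vertex_power_sum n k | k. 1 \<le> k \<and> k \<le> n} = (vertex_power_sum n ` {1..n} :: 'k graph_poly set)"
    by auto
  ultimately show ?thesis
    by (simp only: card_Un_disjoint finite_imageI finite_atLeastAtMost card_image card_atLeastAtMost diff_Suc_1 One_nat_def)
qed

theorem proposition4p3:
  fixes n :: nat
  assumes "3 \<le> n" and "n \<le> 5"
  shows "system_of_parameters n
    ({edge_power_sum n k | k. 2 \<le> k \<and> k \<le> (n - 1) choose 2} \<union>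
     {vertex_power_sum n k | k. 1 \<le> k \<and> k \<le> n} :: 'k::field_char_0 graph_poly set)"
    (is "system_of_parameters n ?S")
proof -
  have n: "n = 3 \<or> n = 4 \<or> n = 5"
    using assms by auto
  \<comment> \<open>For \<open>n = 3\<close> the upper bound is 1, so no edge power sums occur; for
    4 and 5 it is 3 and 6, as in \<open>edges_mem_4\<close> and \<open>edges_mem_5\<close>.\<close>
  have choose: "(2::nat) choose 2 = 1" "(3::nat) choose 2 = 3" "(4::nat) choose 2 = 6" "(5::nat) choose 2 = 10"
    by (simp_all add: choose_two)
  have fin: "finite ?S"
    by simp
  have inv: "?S \<subseteq> invariants n"
    using edge_power_sum_in_invariants vertex_power_sum_in_invariants by auto
  have homog: "\<exists>d>0. homogeneous_of_degree d s" if s: "s \<in> ?S" for s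
  proof -
    from s consider k where "2 \<le> k" "s = edge_power_sum n k" | k where "1 \<le> k" "s = vertex_power_sum n k"
      by auto
    then show ?thesis
    proof cases
      case (1 k)
      then show ?thesis by (intro exI[of _ k]) (simp add: homogeneous_edge_power_sum)
    next
      case (2 k)
      then show ?thesis by (intro exI[of _ k]) (simp add: homogeneous_vertex_power_sum)
    qed
  qed
  interpret R: radical_ideal "radical_of ?S"
    by (rule radical_ideal_radical_of)
  have gen: "s \<in> radical_of ?S" if "s \<in> ?S" for s
    unfolding radical_of_def using span_over_base[OF subsemiring_UNIV fin that]
    by (intro CollectI exI[of _ 1]) simp
  have vertex: "(\<Sum>j\<in>{1..n} - {i}. Var {i, j}) \<in> radical_of ?S" if "i \<in> {1..n}" for i
  proof (rule R.vertex_sums_mem[OF _ that])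
    fix k assume "1 \<le> k" "k \<le> n"
    then have "vertex_power_sum n k \<in> radical_of ?S"
      by (intro gen) auto
    then show "(\<Sum>i=1..n. (\<Sum>j\<in>{1..n} - {i}. Var {i, j}) ^ k) \<in> radical_of ?S"
      by (simp add: vertex_power_sum_def X_def)
  qed
  have edge: "(\<Sum>i=1..n. \<Sum>j\<in>{i<..n}. Var {i, j} ^ k) \<in> radical_of ?S" if "2 \<le> k" "k \<le> (n - 1) choose 2" for k
    using gen[of "edge_power_sum n k"] that by (auto simp: edge_power_sum_def)
  have "Var e \<in> radical_of ?S" if "e \<in> edges n" for e
    using n
  proof (elim disjE)
    assume "n = 3"
    with vertex that show ?thesis using R.edges_mem_3[of Var e] by simp
  next
    assume "n = 4"
    with vertex edge that show ?thesis using R.edges_mem_4[of Var e] by (simp add: choose)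
  next
    assume "n = 5"
    with vertex edge that show ?thesis using R.edges_mem_5[of Var e] by (simp add: choose)
  qed
  then have "finitely_generated_over (adjoin ?S) (invariants n)"
    using invariants_finitely_generated[OF fin inv homog] by blast
  \<comment> \<open>With \<open>m = (n - 1) choose 2\<close>, the count \<open>(m - 1) + n\<close>
    is \<open>n choose 2\<close> by Pascal's rule.\<close>
  moreover have "card ?S = n choose 2"
    using card_parameters[of n "(n - 1) choose 2", where 'k = 'k] n assms by (auto simp: choose)
  moreover have "\<forall>p\<in>?S. homogeneous p"
    using homog homogeneous_of_degree_imp_homogeneous by blast
  ultimately show ?thesis
    using fin inv by (simp add: system_of_parameters_def)
qed

end
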